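(* Let $X$ be a random variable whose cumulative distribution function $F$ is absolutely continuous with respect to Lebesgue measure, and assume $E|X|<\infty$. Let $n\ge 3$ be an integer, let $X_1,\dots,X_n$ be independent random variables with common cumulative distribution function $F$, and let $X_{1:n}\le X_{2:n}\le\dots\le X_{n:n}$ be the corresponding order statistics. Then $$F(x)=F_2\left(\frac{x-\mu}{\sigma}\right)\qquad\text{for}\quad -\infty<\mu<\infty,\ \sigma>0$$ (that is, $F$ is of this form for some such constants $\mu,\sigma$), where $F_2$ is the cumulative distribution function of the $t_2$-distribution, if and only if for some integer $k$ with $2\le k\le n-1$ $$E\left[\frac{1}{k-1}\sum_{i=1}^{k-1}(X_{k:n}-X_{i:n})\ \Big|\ X_{k:n}=x\right]=E\left[\frac{1}{n-k}\sum_{j=k+1}^{n}(X_{j:n}-X_{k:n})\ \Big|\ X_{k:n}=x\right].$$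
   Context: The $t_2$-distribution (Student's $t$-distribution with $2$ degrees of freedom) has probability density function $f_2(x)=c_2\left(1+\frac{x^2}{2}\right)^{-3/2}$, $-\infty<x<\infty$, with $c_2=\Gamma(3/2)/(\Gamma(1)\sqrt{2\pi})$; its cumulative distribution function is $F_2(x)=\frac12\left(1+\frac{x}{\sqrt{2+x^2}}\right)$. The displayed identity of conditional expectations is an identity between functions of $x$, holding for almost every $x$ with respect to the distribution of $X_{k:n}$. *)

theory Defs
  imports "HOL-Probability.Probability" "HOL-Real_Asymp.Real_Asymp"
begin

definition t2_pdf :: "real \<Rightarrow> real" where
  "t2_pdf x = Gamma (3 / 2) / (Gamma 1 * sqrt (2 * pi)) * (1 + x\<^sup>2 / 2) powr (- (3 / 2))"

definition t2_cdf :: "real \<Rightarrow> real" where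
  "t2_cdf = cdf (density lborel (\<lambda>x. ennreal (t2_pdf x)))"

definition order_stat :: "(nat \<Rightarrow> 'a \<Rightarrow> real) \<Rightarrow> nat \<Rightarrow> nat \<Rightarrow> 'a \<Rightarrow> real" where
  "order_stat X n k w = sort (map (\<lambda>i. X i w) [1..<n + 1]) ! (k - 1)"

text \<open>
  \<open>cond_exp_given M Y Z x\<close> is \<open>E[Y | Z = x]\<close>: a Borel function of \<open>x\<close> whose composition with
  \<open>Z\<close> is a version of the conditional expectation of \<open>Y\<close> given the sigma-algebra generated by
  \<open>Z\<close>. It is determined up to a null set of the distribution of \<open>Z\<close>; see
  \<open>cond_exp_given_exists\<close> and \<open>cond_exp_given_unique\<close> below.
\<close>
definition is_cond_exp_given ::
    "'a measure \<Rightarrow> ('a \<Rightarrow> real) \<Rightarrow> ('a \<Rightarrow> real) \<Rightarrow> (real \<Rightarrow> real) \<Rightarrow> bool" where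
  "is_cond_exp_given M Y Z g \<longleftrightarrow> g \<in> borel_measurable borel \<and>
     (AE w in M. g (Z w) = real_cond_exp M (vimage_algebra (space M) Z borel) Y w)"

definition cond_exp_given ::
    "'a measure \<Rightarrow> ('a \<Rightarrow> real) \<Rightarrow> ('a \<Rightarrow> real) \<Rightarrow> real \<Rightarrow> real" where
  "cond_exp_given M Y Z = (SOME g. is_cond_exp_given M Y Z g)"

lemma measurable_vimage_factor:
  fixes f :: "'a \<Rightarrow> real" and Z :: "'a \<Rightarrow> real"
  assumes f: "f \<in> borel_measurable (vimage_algebra \<Omega> Z borel)"
  shows "\<exists>g \<in> borel_measurable borel. \<forall>w\<in>\<Omega>. f w = g (Z w)"
proof -
  let ?V = "vimage_algebra \<Omega> Z borel"
  obtain s where s: "\<And>i. simple_function ?V (s i)"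
    and lim: "\<And>w. w \<in> \<Omega> \<Longrightarrow> (\<lambda>i. s i w) \<longlonglongrightarrow> f w"
    using borel_measurable_implies_sequence_metric[OF f, of 0] by auto
  have "\<exists>h \<in> borel_measurable borel. \<forall>w\<in>\<Omega>. s i w = h (Z w)" for i
  proof -
    let ?S = "s i ` \<Omega>"
    have fin: "finite ?S"
      using simple_functionD(1)[OF s[of i]] by simp
    have "\<exists>B\<in>sets borel. s i -` {y} \<inter> \<Omega> = Z -` B \<inter> \<Omega>" for y
      using simple_functionD(2)[OF s[of i], of "{y}"] by (auto simp: sets_vimage_algebra2)
    then obtain B where B: "\<And>y. B y \<in> sets borel"
      and eq: "\<And>y. s i -` {y} \<inter> \<Omega> = Z -` B y \<inter> \<Omega>"
      by metis
    define h where "h x = (\<Sum>y\<in>?S. y * indicator (B y) x)" for x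
    have "h \<in> borel_measurable borel"
      unfolding h_def using B by measurable
    moreover have "s i w = h (Z w)" if w: "w \<in> \<Omega>" for w
    proof -
      have "indicator (B y) (Z w) = (if s i w = y then 1 else 0 :: real)" for y
        using eq[of y] w by (auto simp: indicator_def)
      hence "h (Z w) = (\<Sum>y\<in>?S. if s i w = y then y else 0)"
        unfolding h_def by (intro sum.cong) auto
      also have "\<dots> = s i w"
        using fin w by (simp add: sum.delta)
      finally show ?thesis by simp
    qed
    ultimately show ?thesis by blast
  qed
  then obtain h where h: "\<And>i. h i \<in> borel_measurable borel"
    and sh: "\<And>i w. w \<in> \<Omega> \<Longrightarrow> s i w = h i (Z w)"
    by metis
  have meas: "(\<lambda>x. lim (\<lambda>i. h i x)) \<in> borel_measurable borel"
    using h by (rule borel_measurable_lim_metric)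
  have "f w = lim (\<lambda>i. h i (Z w))" if "w \<in> \<Omega>" for w
    unfolding sh[OF that, symmetric] by (rule limI[OF lim[OF that], symmetric])
  with meas show ?thesis
    by (intro bexI[of _ "\<lambda>x. lim (\<lambda>i. h i x)"] ballI)
qed

lemma cond_exp_given_exists: "is_cond_exp_given M Y Z (cond_exp_given M Y Z)"
proof -
  obtain g where "g \<in> borel_measurable borel"
    "\<forall>w\<in>space M. real_cond_exp M (vimage_algebra (space M) Z borel) Y w = g (Z w)"
    by (rule bexE[OF measurable_vimage_factor[OF borel_measurable_cond_exp]])
  hence "is_cond_exp_given M Y Z g"
    by (auto simp: is_cond_exp_given_def)
  thus ?thesis
    unfolding cond_exp_given_def by (rule someI[of "is_cond_exp_given M Y Z"])
qed

lemma cond_exp_given_unique: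
  assumes [measurable]: "Z \<in> borel_measurable M"
    and g: "is_cond_exp_given M Y Z g" and h: "is_cond_exp_given M Y Z h"
  shows "AE x in distr M borel Z. g x = h x"
proof -
  have [measurable]: "g \<in> borel_measurable borel" "h \<in> borel_measurable borel"
    using g h by (auto simp: is_cond_exp_given_def)
  have "AE w in M. g (Z w) = h (Z w)"
    using g h by (auto simp: is_cond_exp_given_def)
  thus ?thesis
    by (subst AE_distr_iff) auto
qed

lemma t2_pdf_eq: "t2_pdf x = (2 + x\<^sup>2) powr (- (3 / 2))"
proof -
  have G: "Gamma (3 / 2 :: real) = sqrt pi / 2"
  proof -
    have "(1 / 2 :: real) \<notin> \<int>\<^sub>\<le>\<^sub>0"
      using nonpos_Ints_nonpos[of "1 / 2 :: real"] by auto
    from Gamma_plus1[OF this] show ?thesis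
      by (simp add: Gamma_one_half_real)
  qed
  have "2 + x\<^sup>2 = 2 * (1 + x\<^sup>2 / 2)"
    by simp
  hence "(2 + x\<^sup>2) powr (- (3/2)) = (2 * (1 + x\<^sup>2 / 2)) powr (- (3/2))"
    by (rule arg_cong)
  also have "\<dots> = 2 powr (- (3/2)) * (1 + x\<^sup>2 / 2) powr (- (3/2))"
    by (subst powr_mult) (auto simp: add_nonneg_nonneg)
  also have "(2::real) powr (- (3/2)) = 1 / (2 * sqrt 2)"
  proof -
    have "(2::real) powr (3/2) = 2 powr (1 + 1/2)" by simp
    also have "\<dots> = 2 * sqrt 2" by (subst powr_add) (simp add: powr_half_sqrt)
    finally show ?thesis by (simp add: powr_minus_divide)
  qed
  finally show ?thesis
    unfolding t2_pdf_def G by (simp add: real_sqrt_mult)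
qed

lemma t2_cdf_eq: "t2_cdf x = 1 / 2 * (1 + x / sqrt (2 + x\<^sup>2))"
proof -
  define G where "G t = t / (2 * sqrt (2 + t\<^sup>2))" for t :: real
  have meas [measurable]: "t2_pdf \<in> borel_measurable borel"
    unfolding t2_pdf_def by measurable
  have pos: "2 + t\<^sup>2 > (0::real)" for t
    by (simp add: add_pos_nonneg)
  have nn: "t2_pdf t \<ge> 0" for t
    by (simp add: t2_pdf_eq)
  have der: "(G has_real_derivative t2_pdf t) (at t)" for t
  proof -
    have pd: "t2_pdf t = 1 / (sqrt (2 + t\<^sup>2) * (2 + t\<^sup>2))"
    proof -
      have "(2 + t\<^sup>2) powr (3/2) = (2 + t\<^sup>2) powr (1/2 + 1)" by simp
      also have "\<dots> = sqrt (2 + t\<^sup>2) * (2 + t\<^sup>2)"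
        using pos[of t] by (subst powr_add) (simp add: powr_half_sqrt)
      finally show ?thesis by (simp add: t2_pdf_eq powr_minus_divide)
    qed
    have sq: "sqrt (2 + t\<^sup>2) * sqrt (2 + t\<^sup>2) = 2 + t\<^sup>2"
      using pos[of t] by simp
    have "(G has_real_derivative
        (1 * (2 * sqrt (2 + t\<^sup>2)) - t * (2 * (inverse (sqrt (2 + t\<^sup>2)) / 2 * (2 * t))))
          / (2 * sqrt (2 + t\<^sup>2) * (2 * sqrt (2 + t\<^sup>2)))) (at t)"
      unfolding G_def using pos[of t]
      by (auto intro!: derivative_eq_intros simp: power2_eq_square)
    also have "(1 * (2 * sqrt (2 + t\<^sup>2)) - t * (2 * (inverse (sqrt (2 + t\<^sup>2)) / 2 * (2 * t))))
          / (2 * sqrt (2 + t\<^sup>2) * (2 * sqrt (2 + t\<^sup>2))) = t2_pdf t"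
    proof -
      define r where "r = sqrt (2 + t\<^sup>2)"
      have r: "r > 0" "2 + t\<^sup>2 = r * r" using pos[of t] sq by (auto simp: r_def)
      have tt: "t * t = r * r - 2" using r(2) by (simp add: power2_eq_square)
      have "(1 * (2 * r) - t * (2 * (inverse r / 2 * (2 * t)))) / (2 * r * (2 * r))
          = (2 * (r * r) - 2 * (t * t)) / (4 * r * r * r)"
        using r(1) by (simp add: field_simps)
      also have "\<dots> = 1 / (r * (r * r))"
        unfolding tt using r(1) by (simp add: field_simps)
      finally show ?thesis
        unfolding pd r_def[symmetric] unfolding r(2) .
    qed
    finally show ?thesis .
  qed
  have "(G \<longlongrightarrow> 1 / 2) at_top"
    unfolding G_def by real_asymp
  hence F: "(\<integral>\<^sup>+t. ennreal (t2_pdf t) * indicator {- x..} t \<partial>lborel) = ennreal (1 / 2 - G (- x))"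
    by (intro nn_integral_FTC_atLeast der) (auto simp: nn)
  have "emeasure (density lborel (\<lambda>x. ennreal (t2_pdf x))) {..x}
      = (\<integral>\<^sup>+t. ennreal (t2_pdf t) * indicator {..x} t \<partial>lborel)"
    by (subst emeasure_density) auto
  also have "\<dots> = (\<integral>\<^sup>+t. ennreal (t2_pdf (- t)) * indicator {..x} (- t) \<partial>lborel)"
    by (subst nn_integral_real_affine[of _ "-1" 0]) auto
  also have "\<dots> = (\<integral>\<^sup>+t. ennreal (t2_pdf t) * indicator {- x..} t \<partial>lborel)"
    by (intro nn_integral_cong) (auto simp: t2_pdf_def indicator_def)
  also note F
  finally have E: "emeasure (density lborel (\<lambda>x. ennreal (t2_pdf x))) {..x} = ennreal (1 / 2 - G (- x))" .
  have "\<bar>x\<bar> \<le> sqrt (2 + x\<^sup>2)"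
    by (rule real_le_rsqrt) simp
  hence "- 1 \<le> x / sqrt (2 + x\<^sup>2)"
    using pos[of x] by (subst pos_le_divide_eq) auto
  moreover have H: "1 / 2 - G (- x) = 1 / 2 * (1 + x / sqrt (2 + x\<^sup>2))"
    by (simp add: G_def)
  ultimately have nonneg: "0 \<le> 1 / 2 - G (- x)"
    unfolding H by simp
  have "t2_cdf x = enn2real (ennreal (1 / 2 - G (- x)))"
    unfolding t2_cdf_def cdf_def measure_def E ..
  also have "\<dots> = 1 / 2 - G (- x)"
    using nonneg by (rule enn2real_ennreal)
  finally show ?thesis
    unfolding H .
qed

end

theory Submission
  imports Defs
begin

text \<open>
  Write \<open>F\<close> for the distribution function, \<open>A x = E (x - X)\<^sup>+\<close> and \<open>B x = E (X - x)\<^sup>+\<close>. Given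
  \<open>X\<^bsub>k:n\<^esub> = x\<close>, the \<open>k - 1\<close> smaller observations behave like independent draws of \<open>X\<close>
  conditioned to lie below \<open>x\<close>, and the \<open>n - k\<close> larger ones like draws conditioned to lie above
  \<open>x\<close>. So the two conditional expectations are \<open>A x / F x\<close> and \<open>B x / (1 - F x)\<close>, and for every
  admissible \<open>k\<close> the regression identity says that
  \<open>imbalance x = A x * (1 - F x) - B x * F x\<close> vanishes for \<open>F\<close>-almost every \<open>x\<close>
  (\<open>cond_exp_balance_iff\<close>).

  The analytic part is that this almost sure identity forces the t2 shape
  (\<open>t2_if_balanced\<close>). It first spreads to all \<open>x\<close>: where the imbalance is nonzero
  the law has no mass, so \<open>F\<close> is constant there; but \<open>A' = F\<close> and \<open>B' = F - 1\<close> make the imbalance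
  nondecreasing wherever \<open>F\<close> is constant, so it could not return to zero at the far end of such a gap
  (\<open>imbalance_nonpos\<close>, \<open>imbalance_nonneg\<close>). With \<open>S = A + B = E |X - x|\<close> the identity now reads
  \<open>A = F S\<close>, whence \<open>S S' = S (2 F - 1) = A - B = x - E X\<close>. Thus \<open>S\<^sup>2 - (x - E X)\<^sup>2\<close> is a positive
  constant and \<open>F = (1 + S') / 2 = (1 + (x - E X) / S) / 2\<close>, which is the t2 distribution function
  up to location and scale. Conversely, for a t2 law \<open>A\<close> and \<open>B\<close> are determined by their
  derivatives and their limits at infinity (\<open>balanced_if_t2\<close>).

  The probabilistic part never constructs a conditional distribution. Two conditional
  expectations given \<open>Z\<close> agree iff the integrals over all events \<open>Z \<in> B\<close> agree
  (\<open>cond_exp_given_eq_iff\<close>). For \<open>Z = X\<^bsub>k:n\<^esub>\<close> such an integral is split according to which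
  observation \<open>j\<close> is the \<open>k\<close>-th smallest and which set \<open>T\<close> of observations lies below it; there
  are almost surely no ties, so exactly one pair \<open>(j, T)\<close> applies (\<open>sum_splits\<close>). On each piece the
  integrand is a product over the sample once \<open>X\<^sub>j\<close> is held fixed, and Fubini evaluates it
  (\<open>nn_integral_condition_on\<close>, \<open>nn_integral_split\<close>). The number of pieces is the same on both
  sides of the identity, so it cancels without being computed.
\<close>

section \<open>One-sided mean deviations of an atomless law\<close>

locale atomless_law = real_distribution D for D :: "real measure" +
  assumes atomless: "measure D {x} = 0"
    and integrable_id: "integrable D (\<lambda>y. y)"
begin

text \<open>
  Since \<open>E (x - X)\<^sup>+\<close> is the integral of the distribution function up to \<open>x\<close>, \<open>lower\<close> is an
  antiderivative of it; \<open>upper\<close> is likewise an antiderivative of minus the survival function.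
\<close>
definition lower :: "real \<Rightarrow> real" where
  "lower x = (\<integral>y. max (x - y) 0 \<partial>D)"

definition upper :: "real \<Rightarrow> real" where
  "upper x = (\<integral>y. max (y - x) 0 \<partial>D)"

definition mean :: real where
  "mean = (\<integral>y. y \<partial>D)"

text \<open>
  After division by \<open>F x * (1 - F x)\<close> this is the difference between
  \<open>x - E (X | X < x)\<close> and \<open>E (X | X > x) - x\<close>; the form without denominators is defined, and
  continuous, on the whole line.
\<close>
definition imbalance :: "real \<Rightarrow> real" where
  "imbalance x = lower x * (1 - cdf D x) - upper x * cdf D x"

lemma integrable_lower: "integrable D (\<lambda>y. max (x - y) 0)"
  and integrable_upper: "integrable D (\<lambda>y. max (y - x) 0)"
  using integrable_id by (auto intro!: integrable_max)

lemma lower_nonneg: "0 \<le> lower x" and upper_nonneg: "0 \<le> upper x"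
  by (auto simp: lower_def upper_def)

lemma lower_minus_upper: "lower x - upper x = x - mean"
proof -
  have "lower x - upper x = (\<integral>y. max (x - y) 0 - max (y - x) 0 \<partial>D)"
    unfolding lower_def upper_def
    by (rule Bochner_Integration.integral_diff[symmetric]) (rule integrable_lower integrable_upper)+
  also have "\<dots> = (\<integral>y. x - y \<partial>D)"
    by (intro Bochner_Integration.integral_cong) auto
  also have "\<dots> = x - mean"
    using integrable_id prob_space by (simp add: mean_def)
  finally show ?thesis .
qed

lemma lower_plus_upper: "lower x + upper x = (\<integral>y. \<bar>y - x\<bar> \<partial>D)"
proof -
  have "lower x + upper x = (\<integral>y. max (x - y) 0 + max (y - x) 0 \<partial>D)"
    unfolding lower_def upper_def
    by (rule Bochner_Integration.integral_add[symmetric]) (rule integrable_lower integrable_upper)+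
  also have "\<dots> = (\<integral>y. \<bar>y - x\<bar> \<partial>D)"
    by (intro Bochner_Integration.integral_cong) auto
  finally show ?thesis .
qed

text \<open>
  A zero mean absolute deviation would concentrate the law at \<open>x\<close>.
\<close>
lemma lower_plus_upper_pos: "0 < lower x + upper x"
proof -
  have int: "integrable D (\<lambda>y. \<bar>y - x\<bar>)"
    using integrable_id by auto
  have "lower x + upper x \<noteq> 0"
  proof
    assume "lower x + upper x = 0"
    hence "(\<integral>y. \<bar>y - x\<bar> \<partial>D) = 0"
      by (simp add: lower_plus_upper)
    hence "AE y in D. y \<in> {x}"
      using int by (subst (asm) integral_nonneg_eq_0_iff_AE) auto
    hence "measure D {x} = 1"
      by (subst prob_eq_1) auto
    thus False
      using atomless by simp
  qed
  thus ?thesis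
    using lower_nonneg[of x] upper_nonneg[of x] by linarith
qed

lemma lower_eq_0_if_cdf_eq_0:
  assumes "cdf D x = 0"
  shows "lower x = 0"
proof -
  have "AE y in D. y \<notin> {..x}"
    using assms by (subst prob_eq_0[symmetric]) (auto simp: cdf_def)
  hence "AE y in D. max (x - y) 0 = 0"
    by eventually_elim auto
  thus ?thesis
    unfolding lower_def by (rule integral_eq_zero_AE)
qed

lemma upper_eq_0_if_cdf_eq_1:
  assumes "cdf D x = 1"
  shows "upper x = 0"
proof -
  have "AE y in D. y \<in> {..x}"
    using assms by (subst prob_eq_1[symmetric]) (auto simp: cdf_def)
  hence "AE y in D. max (y - x) 0 = 0"
    by eventually_elim auto
  thus ?thesis
    unfolding upper_def by (rule integral_eq_zero_AE)
qed

lemma isCont_cdf_atomless: "isCont (cdf D) x"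
  by (simp add: isCont_cdf atomless)

text \<open>
  Between \<open>x\<close> and \<open>y\<close> the integrand \<open>(t - z)\<^sup>+\<close> grows at unit rate for every \<open>z \<le> x\<close> and at
  most at unit rate for \<open>z \<le> y\<close>, and it stays \<open>0\<close> for larger \<open>z\<close>.
\<close>
lemma lower_increment:
  assumes "x \<le> y"
  shows "cdf D x * (y - x) \<le> lower y - lower x" "lower y - lower x \<le> cdf D y * (y - x)"
proof -
  have cdf_int: "cdf D t * (y - x) = (\<integral>z. indicator {..t} z * (y - x) \<partial>D)" for t
    by (simp add: cdf_def)
  have int: "integrable D (\<lambda>z. indicator {..t} z * (y - x))" for t
    by (intro integrable_mult_left integrable_real_indicator) (auto simp: emeasure_eq_measure)
  have diff: "lower y - lower x = (\<integral>z. max (y - z) 0 - max (x - z) 0 \<partial>D)"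
    unfolding lower_def
    by (rule Bochner_Integration.integral_diff[symmetric]) (rule integrable_lower)+
  have int': "integrable D (\<lambda>z. max (y - z) 0 - max (x - z) 0)"
    by (intro Bochner_Integration.integrable_diff integrable_lower)
  show "cdf D x * (y - x) \<le> lower y - lower x"
    unfolding diff cdf_int using assms
    by (intro integral_mono int int') (auto simp: indicator_def)
  show "lower y - lower x \<le> cdf D y * (y - x)"
    unfolding diff cdf_int using assms
    by (intro integral_mono int int') (auto simp: indicator_def)
qed

lemma DERIV_lower: "(lower has_real_derivative cdf D x) (at x)"
proof -
  have bound: "\<bar>(lower (x + h) - lower x) / h - cdf D x\<bar> \<le> \<bar>cdf D (x + h) - cdf D x\<bar>"
    if "h \<noteq> 0" for h
  proof (cases "h > 0")
    case True
    have "cdf D x \<le> (lower (x + h) - lower x) / h" "(lower (x + h) - lower x) / h \<le> cdf D (x + h)"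
      using lower_increment[of x "x + h"] True by (simp_all add: field_simps)
    thus ?thesis by linarith
  next
    case False
    hence "h < 0" using that by simp
    hence "(lower (x + h) - lower x) / h \<le> cdf D x" "cdf D (x + h) \<le> (lower (x + h) - lower x) / h"
      using lower_increment[of "x + h" x] by (simp_all add: field_simps)
    thus ?thesis by linarith
  qed
  have "(\<lambda>h. cdf D (x + h)) \<midarrow>0\<rightarrow> cdf D x"
    using isCont_cdf_atomless[of x] by (simp add: isCont_iff)
  hence "(\<lambda>h. cdf D (x + h) - cdf D x) \<midarrow>0\<rightarrow> 0"
    by (rule LIM_zero)
  moreover have "\<forall>\<^sub>F h in at 0. norm ((lower (x + h) - lower x) / h - cdf D x)
      \<le> norm (cdf D (x + h) - cdf D x)"
    unfolding eventually_at_filter by (intro always_eventually) (use bound in auto)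
  ultimately have "(\<lambda>h. (lower (x + h) - lower x) / h - cdf D x) \<midarrow>0\<rightarrow> 0"
    by (rule Lim_null_comparison[rotated, OF tendsto_norm_zero])
  thus ?thesis
    unfolding DERIV_def by (rule LIM_zero_cancel)
qed

lemma measurable_cdf_lower_upper [measurable]:
  "cdf D \<in> borel_measurable borel" "lower \<in> borel_measurable borel" "upper \<in> borel_measurable borel"
proof -
  have 1: "continuous_on UNIV (cdf D)" "continuous_on UNIV lower"
    using isCont_cdf_atomless DERIV_isCont[OF DERIV_lower]
    by (auto intro: continuous_at_imp_continuous_on)
  have "upper = (\<lambda>x. lower x - x + mean)"
    using lower_minus_upper by (simp add: fun_eq_iff algebra_simps)
  hence "continuous_on UNIV upper"
    by (simp only:) (intro continuous_intros 1(2))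
  with 1 show "cdf D \<in> borel_measurable borel" "lower \<in> borel_measurable borel"
    "upper \<in> borel_measurable borel"
    by (auto intro: borel_measurable_continuous_onI)
qed

lemma imbalance_eq: "imbalance x = lower x - cdf D x * (lower x + upper x)"
  by (simp add: imbalance_def algebra_simps)

lemma imbalance_eq': "imbalance x = lower x - cdf D x * (2 * lower x - x + mean)"
  proof -
  have "lower x + upper x = 2 * lower x - x + mean"
    using lower_minus_upper[of x] by linarith
  thus ?thesis unfolding imbalance_eq by simp
qed

lemma isCont_imbalance: "isCont imbalance x"
proof -
  have "isCont lower x" using DERIV_lower by (rule DERIV_isCont)
  thus ?thesis
    unfolding imbalance_eq'[abs_def] by (intro continuous_intros isCont_cdf_atomless)
qed

end

section \<open>Balanced laws are located and scaled t2 laws\<close>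

lemma t2_cdf_standardize:
  assumes "\<sigma> > 0"
  shows "t2_cdf ((x - \<mu>) / \<sigma>) = (1 + (x - \<mu>) / sqrt ((x - \<mu>)\<^sup>2 + 2 * \<sigma>\<^sup>2)) / 2"
proof -
  have "2 + ((x - \<mu>) / \<sigma>)\<^sup>2 = ((x - \<mu>)\<^sup>2 + 2 * \<sigma>\<^sup>2) / \<sigma>\<^sup>2"
    using assms by (simp add: field_simps)
  hence "sqrt (2 + ((x - \<mu>) / \<sigma>)\<^sup>2) = sqrt ((x - \<mu>)\<^sup>2 + 2 * \<sigma>\<^sup>2) / \<sigma>"
    using assms by (simp add: real_sqrt_divide)
  thus ?thesis
    using assms by (simp add: t2_cdf_eq)
qed

context atomless_law
begin

text \<open>
  If \<open>F\<close> is constantly \<open>p\<close> on an interval, the imbalance is affine there with slope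
  \<open>2 * p * (1 - p)\<close>, which is nonnegative.
\<close>
lemma imbalance_on_gap:
  assumes "x \<le> y" "cdf D x = cdf D y"
  shows "imbalance x \<le> imbalance y"
proof -
  define p where "p = cdf D y"
  have p: "0 \<le> p" "p \<le> 1"
    by (auto simp: p_def cdf_nonneg cdf_bounded_prob)
  have "lower y - lower x = p * (y - x)"
    using lower_increment[OF assms(1)] assms(2) by (simp add: p_def)
  hence l: "lower y = lower x + p * (y - x)" by simp
  have "imbalance y - imbalance x = 2 * p * (1 - p) * (y - x)"
    unfolding imbalance_eq' assms(2) p_def[symmetric] l by (simp add: algebra_simps)
  moreover have "0 \<le> 2 * p * (1 - p) * (y - x)"
    using p assms(1) by simp
  ultimately show ?thesis by linarith
qed

lemma cdf_eqI_null:
  assumes "x \<le> y" "AE z in D. z \<notin> {x<..<y}"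
  shows "cdf D x = cdf D y"
proof (cases "x = y")
  case False
  hence "x < y" using assms by simp
  have "AE z in D. z \<noteq> y"
    using atomless[of y] by (subst (asm) prob_eq_0) auto
  with assms(2) have "AE z in D. z \<notin> {x<..y}"
    by eventually_elim auto
  hence "measure D {x<..y} = 0"
    by (subst prob_eq_0) auto
  thus ?thesis
    using cdf_diff_eq[OF \<open>x < y\<close>] by simp
qed simp

text \<open>
  From a point of positive imbalance move right to the next point where the imbalance is at most
  \<open>0\<close>. The law does not charge the stretch in between, so the imbalance cannot have decreased on
  it. Such a next point exists because otherwise all the mass would lie to the left, and there
  \<open>F x = 1\<close> makes the imbalance nonpositive.
\<close>
lemma imbalance_nonpos:
  assumes AE: "AE z in D. imbalance z = 0"
  shows "imbalance x \<le> 0"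
proof (rule ccontr)
  assume "\<not> imbalance x \<le> 0"
  hence pos: "imbalance x > 0" by simp
  define S where "S = {y. x \<le> y \<and> imbalance y \<le> 0}"
  have cont: "continuous_on UNIV imbalance"
    using isCont_imbalance by (simp add: continuous_at_imp_continuous_on)
  have "S \<noteq> {}"
  proof
    assume "S = {}"
    hence sgn: "imbalance z > 0" if "x \<le> z" for z
      using that by (force simp: S_def)
    have "AE z in D. z \<in> {..x}"
      using AE by eventually_elim (metis sgn atMost_iff less_irrefl linear)
    hence "cdf D x = 1"
      unfolding cdf_def by (subst prob_eq_1) auto
    thus False
      using pos upper_nonneg[of x] by (simp add: imbalance_def)
  qed
  moreover have bdd: "bdd_below S"
    by (auto simp: S_def bdd_below_def)
  moreover have "closed S"
    unfolding S_def using cont by (intro closed_Collect_conj closed_Collect_le) (auto intro: continuous_intros)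
  ultimately have b: "Inf S \<in> S"
    by (rule closed_contains_Inf)
  have gap: "imbalance z \<noteq> 0" if "z \<in> {x<..<Inf S}" for z
  proof
    assume "imbalance z = 0"
    hence "z \<in> S" using that by (auto simp: S_def)
    hence "Inf S \<le> z" using bdd by (rule cInf_lower)
    thus False using that by simp
  qed
  have "cdf D x = cdf D (Inf S)"
  proof (rule cdf_eqI_null)
    show "x \<le> Inf S" using b by (simp add: S_def)
    show "AE z in D. z \<notin> {x<..<Inf S}"
      using AE by eventually_elim (metis gap)
  qed
  hence "imbalance x \<le> imbalance (Inf S)"
    using b by (intro imbalance_on_gap) (auto simp: S_def)
  thus False
    using b pos by (auto simp: S_def)
qed

text \<open>
  The mirror image of the previous argument: from a point of negative imbalance move left.
\<close>
lemma imbalance_nonneg: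
  assumes AE: "AE z in D. imbalance z = 0"
  shows "0 \<le> imbalance x"
proof (rule ccontr)
  assume "\<not> 0 \<le> imbalance x"
  hence neg: "imbalance x < 0" by simp
  define S where "S = {y. y \<le> x \<and> 0 \<le> imbalance y}"
  have cont: "continuous_on UNIV imbalance"
    using isCont_imbalance by (simp add: continuous_at_imp_continuous_on)
  have "S \<noteq> {}"
  proof
    assume "S = {}"
    hence sgn: "imbalance z < 0" if "z \<le> x" for z
      using that by (force simp: S_def)
    have "AE z in D. z \<notin> {..x}"
      using AE by eventually_elim (metis sgn atMost_iff less_irrefl)
    hence "cdf D x = 0"
      unfolding cdf_def by (subst prob_eq_0) auto
    thus False
      using neg lower_nonneg[of x] by (simp add: imbalance_def)
  qed
  moreover have bdd: "bdd_above S"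
    by (auto simp: S_def bdd_above_def)
  moreover have "closed S"
    unfolding S_def using cont by (intro closed_Collect_conj closed_Collect_le) (auto intro: continuous_intros)
  ultimately have b: "Sup S \<in> S"
    by (rule closed_contains_Sup)
  have gap: "imbalance z \<noteq> 0" if "z \<in> {Sup S<..<x}" for z
  proof
    assume "imbalance z = 0"
    hence "z \<in> S" using that by (auto simp: S_def)
    hence "z \<le> Sup S" using bdd by (rule cSup_upper)
    thus False using that by simp
  qed
  have "cdf D (Sup S) = cdf D x"
  proof (rule cdf_eqI_null)
    show "Sup S \<le> x" using b by (simp add: S_def)
    show "AE z in D. z \<notin> {Sup S<..<x}"
      using AE by eventually_elim (metis gap)
  qed
  hence "imbalance (Sup S) \<le> imbalance x"
    using b by (intro imbalance_on_gap) (auto simp: S_def)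
  thus False
    using b neg by (auto simp: S_def)
qed

text \<open>
  The location turns out to be the mean, and the scale is \<open>E |X - E X| / sqrt 2\<close>: at the mean the
  conserved quantity \<open>S\<^sup>2 - (x - E X)\<^sup>2\<close> equals \<open>(E |X - E X|)\<^sup>2\<close>, and it must be \<open>2 * \<sigma>\<^sup>2\<close>.
\<close>
lemma t2_if_balanced:
  assumes "AE z in D. imbalance z = 0"
  shows "\<exists>\<mu> \<sigma>. \<sigma> > 0 \<and> (\<forall>x. cdf D x = t2_cdf ((x - \<mu>) / \<sigma>))"
proof -
  define S where "S x = lower x + upper x" for x
  have S_eq: "S x = 2 * lower x - x + mean" for x
    using lower_minus_upper[of x] by (simp add: S_def)
  have S_pos: "S x > 0" for x
    using lower_plus_upper_pos by (simp add: S_def)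
  \<comment> \<open>The exceptional null set disappears here: the balance holds at every point.\<close>
  have bal: "lower x = cdf D x * S x" for x
    using imbalance_nonpos[OF assms, of x] imbalance_nonneg[OF assms, of x]
    by (simp add: imbalance_eq S_def)
  have "((\<lambda>x. (S x)\<^sup>2 - (x - mean)\<^sup>2) has_real_derivative 0) (at x)" for x
  proof -
    have "(S has_real_derivative 2 * cdf D x - 1) (at x)"
      unfolding S_eq[abs_def] by (auto intro!: derivative_eq_intros DERIV_lower)
    hence "((\<lambda>x. (S x)\<^sup>2 - (x - mean)\<^sup>2) has_real_derivative
        2 * S x * (2 * cdf D x - 1) - 2 * (x - mean)) (at x)"
      by (auto intro!: derivative_eq_intros)
    moreover have "2 * S x * (2 * cdf D x - 1) - 2 * (x - mean) = 0"
    proof -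
      have "2 * S x * (2 * cdf D x - 1) = 4 * lower x - 2 * S x"
        unfolding bal[of x] by (simp add: algebra_simps)
      thus ?thesis by (simp add: S_eq)
    qed
    ultimately show ?thesis by (simp only:)
  qed
  hence const: "(S x)\<^sup>2 - (x - mean)\<^sup>2 = (S mean)\<^sup>2 - (mean - mean)\<^sup>2" for x
    by (rule DERIV_isconst_all[rule_format])
  have S_sq: "(S x)\<^sup>2 = (x - mean)\<^sup>2 + (S mean)\<^sup>2" for x
    using const[of x] by simp
  define \<sigma> where "\<sigma> = S mean / sqrt 2"
  have \<sigma>: "\<sigma> > 0" "2 * \<sigma>\<^sup>2 = (S mean)\<^sup>2"
    using S_pos[of mean] by (auto simp: \<sigma>_def power_divide)
  have "cdf D x = t2_cdf ((x - mean) / \<sigma>)" for x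
  proof -
    have "sqrt ((x - mean)\<^sup>2 + 2 * \<sigma>\<^sup>2) = sqrt ((S x)\<^sup>2)"
      using S_sq[of x] \<sigma>(2) by simp
    hence "sqrt ((x - mean)\<^sup>2 + 2 * \<sigma>\<^sup>2) = S x"
      using S_pos[of x] by simp
    moreover have "cdf D x = (1 + (x - mean) / S x) / 2"
    proof -
      have "cdf D x = lower x / S x"
        using bal[of x] S_pos[of x] by simp
      also have "\<dots> = (S x + (x - mean)) / 2 / S x"
        using S_eq[of x] by simp
      also have "\<dots> = (1 + (x - mean) / S x) / 2"
        using S_pos[of x] by (simp add: add_divide_distrib)
      finally show ?thesis .
    qed
    ultimately show ?thesis
      using t2_cdf_standardize[OF \<sigma>(1), of x mean] by simp
  qed
  thus ?thesis using \<sigma>(1) by blast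
qed

lemma lower_at_bot: "((\<lambda>t. lower (- t)) \<longlongrightarrow> 0) at_top"
proof -
  have "((\<lambda>t. \<integral>y. max (- t - y) 0 \<partial>D) \<longlongrightarrow> (\<integral>y. 0 \<partial>D)) at_top"
  proof (rule integral_dominated_convergence_at_top[where w = "\<lambda>y. \<bar>y\<bar>"])
    show "\<forall>\<^sub>F t in at_top. AE y in D. norm (max (- t - y) 0) \<le> \<bar>y\<bar>"
      using eventually_ge_at_top[of "0::real"] by eventually_elim auto
    show "AE y in D. ((\<lambda>t. max (- t - y) 0) \<longlongrightarrow> 0) at_top"
    proof (rule AE_I2)
      fix y :: real
      have "\<forall>\<^sub>F t in at_top. max (- t - y) 0 = 0"
        using eventually_ge_at_top[of "- y"] by eventually_elim auto
      thus "((\<lambda>t. max (- t - y) 0) \<longlongrightarrow> 0) at_top"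
        by (rule tendsto_eventually)
    qed
    show "integrable D (\<lambda>y. \<bar>y\<bar>)"
      using integrable_id by (rule integrable_abs)
  qed simp_all
  thus ?thesis by (simp add: lower_def)
qed

lemma upper_at_top: "(upper \<longlongrightarrow> 0) at_top"
proof -
  have "((\<lambda>t. \<integral>y. max (y - t) 0 \<partial>D) \<longlongrightarrow> (\<integral>y. 0 \<partial>D)) at_top"
  proof (rule integral_dominated_convergence_at_top[where w = "\<lambda>y. \<bar>y\<bar>"])
    show "\<forall>\<^sub>F t in at_top. AE y in D. norm (max (y - t) 0) \<le> \<bar>y\<bar>"
      using eventually_ge_at_top[of "0::real"] by eventually_elim auto
    show "AE y in D. ((\<lambda>t. max (y - t) 0) \<longlongrightarrow> 0) at_top"
    proof (rule AE_I2)
      fix y :: real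
      have "\<forall>\<^sub>F t in at_top. max (y - t) 0 = 0"
        using eventually_ge_at_top[of y] by eventually_elim auto
      thus "((\<lambda>t. max (y - t) 0) \<longlongrightarrow> 0) at_top"
        by (rule tendsto_eventually)
    qed
    show "integrable D (\<lambda>y. \<bar>y\<bar>)"
      using integrable_id by (rule integrable_abs)
  qed simp_all
  thus ?thesis by (simp add: upper_def[abs_def])
qed

text \<open>
  The function \<open>(x - \<mu> + sqrt ((x - \<mu>)\<^sup>2 + 2 * \<sigma>\<^sup>2)) / 2\<close> is an antiderivative of \<open>F\<close>, hence equals
  \<open>lower\<close> up to a constant \<open>c\<close>. The limit at minus infinity gives \<open>c = 0\<close>, and the limit of \<open>upper\<close>
  at plus infinity then identifies \<open>\<mu>\<close> with the mean.
\<close>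
lemma balanced_if_t2:
  assumes "\<sigma> > 0" and F: "\<And>x. cdf D x = t2_cdf ((x - \<mu>) / \<sigma>)"
  shows "imbalance x = 0"
proof -
  define R where "R x = sqrt ((x - \<mu>)\<^sup>2 + 2 * \<sigma>\<^sup>2)" for x
  have pos: "(x - \<mu>)\<^sup>2 + 2 * \<sigma>\<^sup>2 > 0" for x
    using assms(1) by (intro add_nonneg_pos) auto
  have R_pos: "R x > 0" for x
    using pos by (simp add: R_def)
  have F_eq: "cdf D x = (1 + (x - \<mu>) / R x) / 2" for x
    unfolding F R_def by (rule t2_cdf_standardize[OF assms(1)])
  have "((\<lambda>x. lower x - (x - \<mu> + R x) / 2) has_real_derivative 0) (at x)" for x
  proof -
    have "(R has_real_derivative (x - \<mu>) / R x) (at x)"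
      unfolding R_def[abs_def] using pos[of x]
      by (auto intro!: derivative_eq_intros simp: field_simps)
    hence "((\<lambda>x. lower x - (x - \<mu> + R x) / 2) has_real_derivative
        cdf D x - (1 + (x - \<mu>) / R x) / 2) (at x)"
      by (auto intro!: derivative_eq_intros DERIV_lower)
    thus ?thesis by (simp add: F_eq)
  qed
  hence const: "lower x - (x - \<mu> + R x) / 2 = lower \<mu> - (\<mu> - \<mu> + R \<mu>) / 2" for x
    by (rule DERIV_isconst_all[rule_format])
  define c where "c = lower \<mu> - (\<mu> - \<mu> + R \<mu>) / 2"
  have L: "lower x = (x - \<mu> + R x) / 2 + c" for x
    using const[of x] by (simp add: c_def)
  have U: "upper x = (R x - (x - \<mu>)) / 2 + (c + mean - \<mu>)" for x
    using L[of x] lower_minus_upper[of x] by (simp add: field_simps)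
  have "((\<lambda>t. (- t - \<mu> + R (- t)) / 2 + c) \<longlongrightarrow> 0 + c) at_top"
    unfolding R_def by (intro tendsto_add tendsto_const) real_asymp
  moreover have "((\<lambda>t. (- t - \<mu> + R (- t)) / 2 + c) \<longlongrightarrow> 0) at_top"
    using lower_at_bot by (simp add: L)
  ultimately have c: "0 + c = 0"
    by (rule tendsto_unique[rotated]) simp
  have "((\<lambda>x. (R x - (x - \<mu>)) / 2 + (c + mean - \<mu>)) \<longlongrightarrow> 0 + (c + mean - \<mu>)) at_top"
    unfolding R_def by (intro tendsto_add tendsto_const) real_asymp
  moreover have "((\<lambda>x. (R x - (x - \<mu>)) / 2 + (c + mean - \<mu>)) \<longlongrightarrow> 0) at_top"
    using upper_at_top by (simp add: U[abs_def])
  ultimately have "0 + (c + mean - \<mu>) = 0"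
    by (rule tendsto_unique[rotated]) simp
  with c have "lower x = (x - \<mu> + R x) / 2" "lower x + upper x = R x"
    using L[of x] U[of x] by (simp_all add: field_simps)
  moreover have "cdf D x * R x = (x - \<mu> + R x) / 2"
    using R_pos[of x] by (simp add: F_eq field_simps)
  ultimately show ?thesis by (simp add: imbalance_eq)
qed

end

section \<open>Order statistics of a finite sample\<close>

text \<open>
  Sorting permutes the sample. This turns sums over order statistics into sums over the original
  observations, to which independence applies.
\<close>
lemma sum_order_stat:
  fixes \<phi> :: "real \<Rightarrow> 'c::comm_monoid_add"
  shows "(\<Sum>i = 1..n. \<phi> (order_stat X n i w)) = (\<Sum>m = 1..n. \<phi> (X m w))"
proof -
  define xs where "xs = map (\<lambda>i. X i w) [1..<n + 1]"
  have "(\<Sum>i = 1..n. \<phi> (order_stat X n i w)) = (\<Sum>i<n. \<phi> (sort xs ! i))"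
    unfolding order_stat_def xs_def
    by (rule sum.reindex_bij_witness[of _ Suc "\<lambda>i. i - 1"]) auto
  also have "\<dots> = sum_list (map \<phi> (sort xs))"
  proof -
    have "length xs = n" by (simp add: xs_def)
    thus ?thesis by (simp add: sum_list_sum_nth atLeast0LessThan)
  qed
  also have "\<dots> = sum_list (map \<phi> xs)"
    by (metis mset_map mset_sort sum_mset_sum_list)
  also have "\<dots> = (\<Sum>m = 1..n. \<phi> (X m w))"
    unfolding xs_def map_map by (subst interv_sum_list_conv_sum_set_nat) (auto intro!: sum.cong)
  finally show ?thesis .
qed

lemma order_stat_mono:
  assumes "1 \<le> i" "i \<le> j" "j \<le> n"
  shows "order_stat X n i w \<le> order_stat X n j w"
  unfolding order_stat_def using assms by (intro sorted_nth_mono) auto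

lemma order_stat_in_sample:
  assumes "1 \<le> k" "k \<le> n"
  shows "\<exists>m\<in>{1..n}. order_stat X n k w = X m w"
proof -
  have "order_stat X n k w \<in> set (sort (map (\<lambda>i. X i w) [1..<n + 1]))"
    unfolding order_stat_def using assms by (intro nth_mem) auto
  thus ?thesis by auto
qed

text \<open>
  Taking positive parts extends the sum to all indices for free, after which \<open>sum_order_stat\<close>
  makes it symmetric in the observations.
\<close>
lemma sum_below_order_stat:
  assumes "1 \<le> k" "k \<le> n"
  shows "(\<Sum>i = 1..k - 1. order_stat X n k w - order_stat X n i w) =
    (\<Sum>m = 1..n. max (order_stat X n k w - X m w) 0)"
proof -
  have "(\<Sum>i = 1..k - 1. order_stat X n k w - order_stat X n i w) =
      (\<Sum>i = 1..k - 1. max (order_stat X n k w - order_stat X n i w) 0)"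
    using assms by (intro sum.cong) (auto simp: max_absorb1 order_stat_mono)
  also have "\<dots> = (\<Sum>i = 1..n. max (order_stat X n k w - order_stat X n i w) 0)"
    using assms by (intro sum.mono_neutral_left) (auto simp: max_absorb2 order_stat_mono)
  also have "\<dots> = (\<Sum>m = 1..n. max (order_stat X n k w - X m w) 0)"
    by (rule sum_order_stat)
  finally show ?thesis .
qed

lemma sum_above_order_stat:
  assumes "1 \<le> k" "k \<le> n"
  shows "(\<Sum>j = k + 1..n. order_stat X n j w - order_stat X n k w) =
    (\<Sum>m = 1..n. max (X m w - order_stat X n k w) 0)"
proof -
  have "(\<Sum>j = k + 1..n. order_stat X n j w - order_stat X n k w) =
      (\<Sum>j = k + 1..n. max (order_stat X n j w - order_stat X n k w) 0)"
    using assms by (intro sum.cong) (auto simp: max_absorb1 order_stat_mono)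
  also have "\<dots> = (\<Sum>j = 1..n. max (order_stat X n j w - order_stat X n k w) 0)"
    using assms by (intro sum.mono_neutral_left) (auto simp: max_absorb2 order_stat_mono)
  also have "\<dots> = (\<Sum>m = 1..n. max (X m w - order_stat X n k w) 0)"
    by (rule sum_order_stat)
  finally show ?thesis .
qed

lemma card_sample_Collect:
  "card {m \<in> {1..n}. Q (X m w)} = card {i \<in> {1..n}. Q (order_stat X n i w)}"
  using sum_order_stat[of "\<lambda>v. if Q v then 1 else 0 :: nat" X n w]
  by (simp add: sum.If_cases Int_def conj_commute)

text \<open>
  This reduces an order statistic to counting, which is visibly measurable.
\<close>
lemma order_stat_le_iff:
  assumes "1 \<le> k" "k \<le> n"
  shows "order_stat X n k w \<le> t \<longleftrightarrow> k \<le> card {m \<in> {1..n}. X m w \<le> t}"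
proof
  assume le: "order_stat X n k w \<le> t"
  have "{1..k} \<subseteq> {i \<in> {1..n}. order_stat X n i w \<le> t}"
    using le assms by (auto intro: order_trans[OF order_stat_mono])
  hence "card {1..k} \<le> card {i \<in> {1..n}. order_stat X n i w \<le> t}"
    by (intro card_mono) auto
  thus "k \<le> card {m \<in> {1..n}. X m w \<le> t}"
    using card_sample_Collect[where Q = "\<lambda>v. v \<le> t" and X = X and w = w and n = n] by simp
next
  assume le: "k \<le> card {m \<in> {1..n}. X m w \<le> t}"
  show "order_stat X n k w \<le> t"
  proof (rule ccontr)
    assume "\<not> order_stat X n k w \<le> t"
    hence "i < k" if "i \<in> {1..n}" "order_stat X n i w \<le> t" for i
      using order_stat_mono[of k i n X w] that assms(1) by (cases "i < k") auto
    hence "{i \<in> {1..n}. order_stat X n i w \<le> t} \<subseteq> {1..<k}"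
      by auto
    hence "card {i \<in> {1..n}. order_stat X n i w \<le> t} \<le> card {1..<k}"
      by (intro card_mono) auto
    thus False
      using le assms card_sample_Collect[where Q = "\<lambda>v. v \<le> t" and X = X and w = w and n = n] by simp
  qed
qed

lemma borel_measurable_order_stat:
  assumes [measurable]: "\<And>i. i \<in> {1..n} \<Longrightarrow> X i \<in> borel_measurable M" and k: "1 \<le> k" "k \<le> n"
  shows "order_stat X n k \<in> borel_measurable M"
proof (rule borel_measurableI_le)
  fix t
  have "{w \<in> space M. order_stat X n k w \<le> t} =
      {w \<in> space M. real k \<le> (\<Sum>m = 1..n. indicator {..t} (X m w))}"
    unfolding order_stat_le_iff[OF k] by (simp add: indicator_def sum.If_cases Int_def)
  also have "\<dots> \<in> sets M"
    by measurable
  finally show "{w \<in> space M. order_stat X n k w \<le> t} \<in> sets M" .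
qed

lemma abs_order_stat_le:
  assumes "1 \<le> k" "k \<le> n"
  shows "\<bar>order_stat X n k w\<bar> \<le> (\<Sum>m = 1..n. \<bar>X m w\<bar>)"
proof -
  obtain m where "m \<in> {1..n}" "order_stat X n k w = X m w"
    using order_stat_in_sample[OF assms] by metis
  thus ?thesis
    using member_le_sum[of m "{1..n}" "\<lambda>m. \<bar>X m w\<bar>"] by simp
qed

lemma order_stat_eq_iff_rank:
  assumes inj: "inj_on (\<lambda>m. X m w) {1..n}" and k: "1 \<le> k" "k \<le> n" and j: "j \<in> {1..n}"
  shows "order_stat X n k w = X j w \<longleftrightarrow> card {m \<in> {1..n}. X m w < X j w} = k - 1"
proof -
  define rank where "rank j = card {m \<in> {1..n}. X m w < X j w}" for j
  have rank_less: "rank i < rank j" if "i \<in> {1..n}" "X i w < X j w" for i j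
    unfolding rank_def using that by (intro psubset_card_mono) auto
  have rank_order_stat: "rank i = k - 1" if i: "i \<in> {1..n}" and eq: "order_stat X n k w = X i w" for i
  proof -
    have "rank i \<le> card {1..<k}"
    proof -
      have "{l \<in> {1..n}. order_stat X n l w < X i w} \<subseteq> {1..<k}"
        unfolding eq[symmetric] using k(1) by (auto dest: order_stat_mono[of k _ n X w, OF k(1)] simp flip: not_le)
      thus ?thesis
        unfolding rank_def
        by (subst card_sample_Collect[where Q = "\<lambda>v. v < X i w"], intro card_mono) auto
    qed
    moreover have "k \<le> Suc (rank i)"
    proof -
      have "k \<le> card {m \<in> {1..n}. X m w \<le> X i w}"
        using order_stat_le_iff[OF k, of X w "X i w"] eq by simp
      also have "{m \<in> {1..n}. X m w \<le> X i w} = insert i {m \<in> {1..n}. X m w < X i w}"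
      proof -
        have "m = i" if "m \<in> {1..n}" "X m w = X i w" for m
          using inj_onD[OF inj that(2)] that(1) i by simp
        thus ?thesis using i by (auto simp: order_le_less)
      qed
      finally show ?thesis by (simp add: rank_def)
    qed
    ultimately show ?thesis using k by simp
  qed
  obtain i where i: "i \<in> {1..n}" "order_stat X n k w = X i w"
    using order_stat_in_sample[OF k] by metis
  have "X i w = X j w" if "rank j = k - 1"
    using rank_less[of i j] rank_less[of j i] rank_order_stat[OF i] i j that
    by (metis less_irrefl linorder_neqE_linordered_idom)
  thus ?thesis
    using rank_order_stat[of j] i(2) j unfolding rank_def[symmetric] by auto
qed

section \<open>Agreement of conditional expectations\<close>

text \<open>
  Nonnegativity of the conditioned variables permits nonnegative integrals on the right-hand side,
  which later frees the use of Fubini from integrability conditions.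
\<close>
lemma (in prob_space) cond_exp_given_eq_iff:
  assumes Z [measurable]: "Z \<in> borel_measurable M"
    and Y: "integrable M Y" "\<And>w. 0 \<le> Y w" and Y': "integrable M Y'" "\<And>w. 0 \<le> Y' w"
  shows "(AE x in distr M borel Z. cond_exp_given M Y Z x = cond_exp_given M Y' Z x) \<longleftrightarrow>
    (\<forall>B\<in>sets borel. (\<integral>\<^sup>+w. indicator B (Z w) * ennreal (Y w) \<partial>M) =
      (\<integral>\<^sup>+w. indicator B (Z w) * ennreal (Y' w) \<partial>M))"
proof -
  let ?V = "vimage_algebra (space M) Z borel"
  have subalg: "subalgebra M ?V"
    unfolding subalgebra_def by (auto simp: sets_vimage_algebra2)
  interpret V: finite_measure_subalgebra M ?V
    by standard (rule subalg)
  have spec: "cond_exp_given M f Z \<in> borel_measurable borel"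
    "AE w in M. cond_exp_given M f Z (Z w) = real_cond_exp M ?V f w" for f
    using cond_exp_given_exists[of M f Z] by (auto simp: is_cond_exp_given_def)
  note [measurable] = spec(1)
  have "(AE x in distr M borel Z. cond_exp_given M Y Z x = cond_exp_given M Y' Z x) \<longleftrightarrow>
      (AE w in M. cond_exp_given M Y Z (Z w) = cond_exp_given M Y' Z (Z w))"
    by (subst AE_distr_iff) auto
  also have "\<dots> \<longleftrightarrow> (AE w in M. real_cond_exp M ?V Y w = real_cond_exp M ?V Y' w)"
    (is "?L \<longleftrightarrow> ?R")
  proof
    assume ?L
    thus ?R using spec(2)[of Y] spec(2)[of Y'] by eventually_elim simp
  next
    assume ?R
    thus ?L using spec(2)[of Y] spec(2)[of Y'] by eventually_elim simp
  qed
  also have "\<dots> \<longleftrightarrow> (\<forall>A\<in>sets ?V. (\<integral>w\<in>A. Y w \<partial>M) = (\<integral>w\<in>A. Y' w \<partial>M))"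
  proof
    assume eq: "AE w in M. real_cond_exp M ?V Y w = real_cond_exp M ?V Y' w"
    show "\<forall>A\<in>sets ?V. (\<integral>w\<in>A. Y w \<partial>M) = (\<integral>w\<in>A. Y' w \<partial>M)"
    proof
      fix A assume A: "A \<in> sets ?V"
      hence [measurable]: "A \<in> sets M"
        using subalg by (auto simp: subalgebra_def)
      have "(\<integral>w\<in>A. Y w \<partial>M) = (\<integral>w\<in>A. real_cond_exp M ?V Y w \<partial>M)"
        by (rule V.real_cond_exp_intA[OF Y(1) A])
      also have "\<dots> = (\<integral>w\<in>A. real_cond_exp M ?V Y' w \<partial>M)"
        using eq by (intro set_lebesgue_integral_cong_AE) auto
      also have "\<dots> = (\<integral>w\<in>A. Y' w \<partial>M)"
        by (rule V.real_cond_exp_intA[OF Y'(1) A, symmetric])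
      finally show "(\<integral>w\<in>A. Y w \<partial>M) = (\<integral>w\<in>A. Y' w \<partial>M)" .
    qed
  next
    assume eq: "\<forall>A\<in>sets ?V. (\<integral>w\<in>A. Y w \<partial>M) = (\<integral>w\<in>A. Y' w \<partial>M)"
    show "AE w in M. real_cond_exp M ?V Y w = real_cond_exp M ?V Y' w"
    proof (rule V.real_cond_exp_charact)
      fix A assume A: "A \<in> sets ?V"
      thus "(\<integral>w\<in>A. Y w \<partial>M) = (\<integral>w\<in>A. real_cond_exp M ?V Y' w \<partial>M)"
        using eq V.real_cond_exp_intA[OF Y'(1) A] by simp
    qed (use Y Y' V.real_cond_exp_int(1) in auto)
  qed
  also have "\<dots> \<longleftrightarrow> (\<forall>B\<in>sets borel. (\<integral>w. indicator B (Z w) * Y w \<partial>M) =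
      (\<integral>w. indicator B (Z w) * Y' w \<partial>M))"
  proof -
    have "(\<integral>w\<in>Z -` B \<inter> space M. f w \<partial>M) = (\<integral>w. indicator B (Z w) * f w \<partial>M)"
      for B and f :: "'a \<Rightarrow> real"
      unfolding set_lebesgue_integral_def
      by (intro Bochner_Integration.integral_cong) (auto simp: indicator_def)
    moreover have "sets ?V = (\<lambda>B. Z -` B \<inter> space M) ` sets borel"
      by (subst sets_vimage_algebra2) auto
    ultimately show ?thesis by simp
  qed
  also have "\<dots> \<longleftrightarrow> (\<forall>B\<in>sets borel. (\<integral>\<^sup>+w. indicator B (Z w) * ennreal (Y w) \<partial>M) =
      (\<integral>\<^sup>+w. indicator B (Z w) * ennreal (Y' w) \<partial>M))"
  proof (rule ball_cong[OF refl])
    fix B :: "real set" assume [measurable]: "B \<in> sets borel"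
    have nn: "(\<integral>\<^sup>+w. indicator B (Z w) * ennreal (f w) \<partial>M) =
        ennreal (\<integral>w. indicator B (Z w) * f w \<partial>M)"
      and pos: "0 \<le> (\<integral>w. indicator B (Z w) * f w \<partial>M)"
      if f: "integrable M f" "\<And>w. 0 \<le> f w" for f
    proof -
      have [measurable]: "f \<in> borel_measurable M"
        using f(1) by simp
      have "integrable M (\<lambda>w. indicator B (Z w) * f w)"
      proof (rule Bochner_Integration.integrable_bound[OF f(1)])
        show "(\<lambda>w. indicator B (Z w) * f w) \<in> borel_measurable M"
          by measurable
      qed (auto simp: indicator_def)
      hence "(\<integral>\<^sup>+w. ennreal (indicator B (Z w) * f w) \<partial>M) =
          ennreal (\<integral>w. indicator B (Z w) * f w \<partial>M)"
        using f(2) by (intro nn_integral_eq_integral) auto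
      thus "(\<integral>\<^sup>+w. indicator B (Z w) * ennreal (f w) \<partial>M) =
          ennreal (\<integral>w. indicator B (Z w) * f w \<partial>M)"
        by (simp add: ennreal_mult' ennreal_indicator)
      show "0 \<le> (\<integral>w. indicator B (Z w) * f w \<partial>M)"
        using f(2) by simp
    qed
    show "(\<integral>w. indicator B (Z w) * Y w \<partial>M) = (\<integral>w. indicator B (Z w) * Y' w \<partial>M) \<longleftrightarrow>
        (\<integral>\<^sup>+w. indicator B (Z w) * ennreal (Y w) \<partial>M) =
        (\<integral>\<^sup>+w. indicator B (Z w) * ennreal (Y' w) \<partial>M)"
      using nn[OF Y] nn[OF Y'] pos[OF Y] pos[OF Y'] by simp
  qed
  finally show ?thesis .
qed

section \<open>Integrals over an independent sample\<close>

text \<open>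
  An indicator rather than an event, so that the product over the other observations is the
  indicator of the configuration in which exactly those with index in \<open>S\<close> lie below \<open>x\<close>.
\<close>
definition side :: "nat set \<Rightarrow> nat \<Rightarrow> real \<Rightarrow> real \<Rightarrow> ennreal" where
  "side S m x y = (if m \<in> S then indicator {..<x} y else indicator {x<..} y)"

locale iid_sample = atomless_law D + M: prob_space M
  for D :: "real measure" and M :: "'b measure" +
  fixes X :: "nat \<Rightarrow> 'b \<Rightarrow> real" and n :: nat
  assumes indep: "M.indep_vars (\<lambda>_. borel) X {1..n}"
    and law: "i \<in> {1..n} \<Longrightarrow> distr M borel (X i) = D"
begin

lemma measurable_sample [measurable]: "i \<in> {1..n} \<Longrightarrow> X i \<in> borel_measurable M"
  using indep by (auto simp: M.indep_vars_def)

text \<open>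
  Fubini for one distinguished observation: with \<open>X\<^sub>j = x\<close> held fixed the remaining observations are
  independent, and the integral of a product of functions of one observation each is the product
  of the integrals.
\<close>
lemma nn_integral_condition_on:
  assumes j: "j \<in> {1..n}"
    and f [measurable]: "f \<in> borel_measurable borel"
    and g: "\<And>m. (\<lambda>(x, y). g m x y) \<in> borel_measurable (borel \<Otimes>\<^sub>M borel)"
  shows "(\<integral>\<^sup>+w. f (X j w) * (\<Prod>m\<in>{1..n} - {j}. g m (X j w) (X m w)) \<partial>M) =
    (\<integral>\<^sup>+x. f x * (\<Prod>m\<in>{1..n} - {j}. \<integral>\<^sup>+y. g m x y \<partial>D) \<partial>D)"
proof -
  define J where "J = {1..n} - {j}"
  have J: "finite J" "j \<notin> J" "insert j J = {1..n}" "J \<subseteq> {1..n}"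
    using j by (auto simp: J_def)
  define H :: "(nat \<Rightarrow> real) \<Rightarrow> ennreal" where "H x = f (x j) * (\<Prod>m\<in>J. g m (x j) (x m))" for x
  have sets_D [measurable_cong]: "sets D = sets borel" by (rule M_is_borel)
  have gm: "(\<lambda>x. g m (u x) (v x)) \<in> borel_measurable N"
    if [measurable]: "u \<in> borel_measurable N" "v \<in> borel_measurable N"
    for m u v and N :: "'c measure"
  proof -
    have "(\<lambda>x. (u x, v x)) \<in> N \<rightarrow>\<^sub>M borel \<Otimes>\<^sub>M borel" by measurable
    from measurable_compose[OF this g[of m]] show ?thesis by simp
  qed
  interpret product_sigma_finite "\<lambda>_::nat. D"
    by unfold_locales
  have H: "H \<in> borel_measurable (\<Pi>\<^sub>M i\<in>{1..n}. borel)"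
    unfolding H_def using j J(4)
    by (intro borel_measurable_times_ennreal borel_measurable_prod_ennreal gm
        measurable_compose[OF _ f] measurable_component_singleton) auto
  have sets_eq: "sets (\<Pi>\<^sub>M i\<in>{1..n}. D) = sets (\<Pi>\<^sub>M i\<in>{1..n}. borel)"
    by (intro sets_PiM_cong) (auto simp: sets_D)
  have joint: "distr M (\<Pi>\<^sub>M i\<in>{1..n}. borel) (\<lambda>w. \<lambda>i\<in>{1..n}. X i w) = (\<Pi>\<^sub>M i\<in>{1..n}. D)"
  proof -
    have "distr M (\<Pi>\<^sub>M i\<in>{1..n}. borel) (\<lambda>w. \<lambda>i\<in>{1..n}. X i w) =
        (\<Pi>\<^sub>M i\<in>{1..n}. distr M borel (X i))"
    proof (rule M.indep_vars_iff_distr_eq_PiM'[THEN iffD1, OF _ _ indep])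
      show "{1..n} \<noteq> {}" using j by auto
    qed (rule measurable_sample)
    also have "\<dots> = (\<Pi>\<^sub>M i\<in>{1..n}. D)"
      by (intro PiM_cong) (auto simp: law)
    finally show ?thesis .
  qed
  have "(\<integral>\<^sup>+w. f (X j w) * (\<Prod>m\<in>J. g m (X j w) (X m w)) \<partial>M) =
      (\<integral>\<^sup>+w. H (\<lambda>i\<in>{1..n}. X i w) \<partial>M)"
    unfolding H_def using j J(4) by (intro nn_integral_cong arg_cong2[of _ _ _ _ "(*)"] prod.cong) auto
  also have "\<dots> = (\<integral>\<^sup>+x. H x \<partial>(\<Pi>\<^sub>M i\<in>{1..n}. D))"
    unfolding joint[symmetric] using H
    by (subst nn_integral_distr) (auto intro!: measurable_restrict measurable_sample)
  also have "\<dots> = (\<integral>\<^sup>+y. \<integral>\<^sup>+x. H (x(j := y)) \<partial>(\<Pi>\<^sub>M i\<in>J. D) \<partial>D)"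
    unfolding J(3)[symmetric] using H measurable_cong_sets[OF sets_eq refl] J
    by (subst product_nn_integral_insert_rev) auto
  also have "\<dots> = (\<integral>\<^sup>+y. f y * (\<Prod>m\<in>J. \<integral>\<^sup>+z. g m y z \<partial>D) \<partial>D)"
  proof (rule nn_integral_cong)
    fix y
    have gD: "g m y \<in> borel_measurable D" for m
      by (rule gm) auto
    have "(\<integral>\<^sup>+x. H (x(j := y)) \<partial>(\<Pi>\<^sub>M i\<in>J. D)) =
        (\<integral>\<^sup>+x. f y * (\<Prod>m\<in>J. g m y (x m)) \<partial>(\<Pi>\<^sub>M i\<in>J. D))"
      unfolding H_def using J(2)
      by (intro nn_integral_cong arg_cong2[of _ _ _ _ "(*)"] prod.cong) auto
    also have "\<dots> = f y * (\<integral>\<^sup>+x. (\<Prod>m\<in>J. g m y (x m)) \<partial>(\<Pi>\<^sub>M i\<in>J. D))"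
    proof (intro nn_integral_cmult borel_measurable_prod_ennreal)
      fix m assume "m \<in> J"
      thus "(\<lambda>x. g m y (x m)) \<in> borel_measurable (\<Pi>\<^sub>M i\<in>J. D)"
        using measurable_compose[OF measurable_component_singleton[of m J "\<lambda>_. D"] gD[of m]] by simp
    qed
    also have "(\<integral>\<^sup>+x. (\<Prod>m\<in>J. g m y (x m)) \<partial>(\<Pi>\<^sub>M i\<in>J. D)) = (\<Prod>m\<in>J. \<integral>\<^sup>+z. g m y z \<partial>D)"
      using J(1) gD by (rule product_nn_integral_prod)
    finally show "(\<integral>\<^sup>+x. H (x(j := y)) \<partial>(\<Pi>\<^sub>M i\<in>J. D)) = f y * (\<Prod>m\<in>J. \<integral>\<^sup>+z. g m y z \<partial>D)" .
  qed
  finally show ?thesis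
    by (simp add: J_def)
qed

text \<open>
  \<open>nn_integral_condition_on\<close> with the indicator of \<open>X\<^sub>i = X\<^sub>j\<close>: the factor belonging to \<open>i\<close> is the
  mass of a single point.
\<close>
lemma AE_no_ties: "AE w in M. inj_on (\<lambda>m. X m w) {1..n}"
proof -
  have ne: "AE w in M. X i w \<noteq> X j w" if ij: "i \<in> {1..n}" "j \<in> {1..n}" "i \<noteq> j" for i j
  proof -
    \<comment> \<open>The product of the \<open>g m\<close> over \<open>m\<close> is the indicator of a tie between \<open>i\<close> and \<open>j\<close>.\<close>
    define g :: "nat \<Rightarrow> real \<Rightarrow> real \<Rightarrow> ennreal" where "g m x y = (if m = i \<and> x \<noteq> y then 0 else 1)" for m x y
    have g: "(\<lambda>(x, y). g m x y) \<in> borel_measurable (borel \<Otimes>\<^sub>M borel)" for m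
      unfolding g_def case_prod_beta by measurable
    have "(\<integral>\<^sup>+y. g i x y \<partial>D) = emeasure D {x}" for x
    proof -
      have "(\<integral>\<^sup>+y. g i x y \<partial>D) = (\<integral>\<^sup>+y. indicator {x} y \<partial>D)"
        by (intro nn_integral_cong) (auto simp: g_def)
      thus ?thesis by simp
    qed
    hence "(\<integral>\<^sup>+y. g i x y \<partial>D) = 0" for x
      by (simp add: emeasure_eq_measure atomless)
    hence zero: "(\<Prod>m\<in>{1..n} - {j}. \<integral>\<^sup>+y. g m x y \<partial>D) = 0" for x
      using ij by (intro prod_zero bexI[of _ i]) auto
    let ?G = "\<lambda>w. 1 * (\<Prod>m\<in>{1..n} - {j}. g m (X j w) (X m w))"
    have "(\<integral>\<^sup>+w. ?G w \<partial>M) = 0"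
      by (subst nn_integral_condition_on[where f = "\<lambda>_. 1", OF ij(2) _ g]) (simp_all only: zero, simp_all)
    moreover have "?G \<in> borel_measurable M"
    proof (intro borel_measurable_times_ennreal borel_measurable_const borel_measurable_prod_ennreal)
      fix m assume "m \<in> {1..n} - {j}"
      hence "(\<lambda>w. (X j w, X m w)) \<in> M \<rightarrow>\<^sub>M borel \<Otimes>\<^sub>M borel"
        using ij(2) by (intro measurable_Pair measurable_sample) auto
      from measurable_compose[OF this g[of m]]
      show "(\<lambda>w. g m (X j w) (X m w)) \<in> borel_measurable M" by simp
    qed
    ultimately have "AE w in M. ?G w = 0"
      by (simp only: nn_integral_0_iff_AE)
    thus ?thesis
    proof eventually_elim
      case (elim w)
      then obtain m where "g m (X j w) (X m w) = 0" by auto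
      thus ?case by (auto simp: g_def split: if_splits)
    qed
  qed
  have "AE w in M. \<forall>p\<in>{p \<in> {1..n} \<times> {1..n}. fst p \<noteq> snd p}. X (fst p) w \<noteq> X (snd p) w"
    by (intro AE_finite_allI) (auto intro: ne)
  thus ?thesis
  proof eventually_elim
    case (elim w)
    show ?case
    proof (intro inj_onI, rule ccontr)
      fix i j assume "i \<in> {1..n}" "j \<in> {1..n}" "X i w = X j w" "i \<noteq> j"
      with elim[rule_format, of "(i, j)"] show False by simp
    qed
  qed
qed

text \<open>
  The candidates for (index of the \<open>k\<close>-th smallest observation, indices of the smaller ones).
\<close>
definition splits :: "nat \<Rightarrow> (nat \<times> nat set) set" where
  "splits k = (SIGMA j:{1..n}. {S. S \<subseteq> {1..n} - {j} \<and> card S = k - 1})"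

lemma finite_splits: "finite (splits k)"
  unfolding splits_def by (intro finite_SigmaI) auto

lemma splits_nonempty:
  assumes "1 \<le> k" "k \<le> n"
  shows "splits k \<noteq> {}"
proof -
  have "(k, {1..<k}) \<in> splits k"
    using assms by (auto simp: splits_def)
  thus ?thesis by auto
qed

text \<open>
  In a sample without ties the order statistic is \<open>X\<^sub>j\<close> for exactly one \<open>j\<close>, and then \<open>S\<close> is
  determined as the set of indices with smaller values. Hence a single summand survives.
\<close>
lemma sum_splits:
  assumes k: "1 \<le> k" "k \<le> n" and inj: "inj_on (\<lambda>m. X m w) {1..n}"
  shows "(\<Sum>(j, S)\<in>splits k. \<psi> (X j w) * (\<Prod>m\<in>{1..n} - {j}. side S m (X j w) (X m w))) =
    \<psi> (order_stat X n k w)"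
proof -
  obtain i where i: "i \<in> {1..n}" "order_stat X n k w = X i w"
    using order_stat_in_sample[OF k] by metis
  define T where "T = {m \<in> {1..n}. X m w < X i w}"
  let ?t = "\<lambda>(j, S). \<psi> (X j w) * (\<Prod>m\<in>{1..n} - {j}. side S m (X j w) (X m w))"
  have mem: "(i, T) \<in> splits k"
    using i order_stat_eq_iff_rank[of X w n k i, OF inj k i(1)] by (auto simp: splits_def T_def)
  have zero: "?t (j, S) = 0" if jS: "(j, S) \<in> splits k" "(j, S) \<noteq> (i, T)" for j S
  proof (rule ccontr)
    have j: "j \<in> {1..n}" and S: "S \<subseteq> {1..n} - {j}" "card S = k - 1"
      using jS(1) by (auto simp: splits_def)
    assume "?t (j, S) \<noteq> 0"
    hence nz: "side S m (X j w) (X m w) \<noteq> 0" if "m \<in> {1..n} - {j}" for m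
      using that by auto
    have S_eq: "S = {m \<in> {1..n}. X m w < X j w}"
    proof (intro set_eqI iffI)
      fix m assume m: "m \<in> S"
      with S(1) have "m \<in> {1..n} - {j}" by auto
      from nz[OF this] this m show "m \<in> {m \<in> {1..n}. X m w < X j w}"
        by (auto simp: side_def indicator_def split: if_splits)
    next
      fix m assume m: "m \<in> {m \<in> {1..n}. X m w < X j w}"
      hence "m \<in> {1..n} - {j}" by auto
      from nz[OF this] m show "m \<in> S"
        by (auto simp: side_def indicator_def split: if_splits)
    qed
    have "order_stat X n k w = X j w"
      using order_stat_eq_iff_rank[of X w n k j, OF inj k j] S(2) S_eq by simp
    hence "j = i"
      using i j inj by (auto dest: inj_onD)
    thus False
      using jS(2) S_eq by (simp add: T_def)
  qed
  have one: "side T m (X i w) (X m w) = 1" if "m \<in> {1..n} - {i}" for m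
  proof -
    have "X m w \<noteq> X i w"
      using that i inj by (auto dest: inj_onD)
    thus ?thesis using that by (auto simp: side_def T_def indicator_def)
  qed
  have "sum ?t (splits k) = sum ?t {(i, T)}"
  proof (intro sum.mono_neutral_right finite_splits ballI)
    fix p assume p: "p \<in> splits k - {(i, T)}"
    obtain j S where jS: "p = (j, S)" by (cases p)
    show "?t p = 0" unfolding jS by (rule zero) (use p in \<open>simp_all add: jS\<close>)
  qed (use mem in simp)
  also have "\<dots> = \<psi> (order_stat X n k w)"
    using one i(2) by simp
  finally show ?thesis .
qed

lemma nn_integral_side:
  "(\<integral>\<^sup>+y. side S m x y \<partial>D) = (if m \<in> S then ennreal (cdf D x) else ennreal (1 - cdf D x))"
proof -
  have "measure D {..x} = measure D ({..<x} \<union> {x})"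
    by (rule arg_cong[of _ _ "measure D"]) auto
  also have "\<dots> = measure D {..<x}"
    by (subst finite_measure_Union) (auto simp: atomless)
  finally have "measure D {..<x} = cdf D x"
    by (simp add: cdf_def)
  moreover have "measure D {x<..} = 1 - cdf D x"
  proof -
    have "{x<..} = UNIV - {..x}" by auto
    thus ?thesis
      using prob_compl[of "{..x}"] by (simp add: cdf_def)
  qed
  ultimately show ?thesis
    by (simp add: side_def emeasure_eq_measure)
qed

lemma measurable_side [measurable]:
  "(\<lambda>p. side S m (fst p) (snd p)) \<in> borel_measurable (borel \<Otimes>\<^sub>M borel)"
proof -
  have "side S m = (\<lambda>x y. if m \<in> S then (if y < x then 1 else 0) else (if x < y then 1 else 0))"
    by (auto simp: side_def indicator_def fun_eq_iff)
  thus ?thesis by simp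
qed

text \<open>
  The deviation \<open>\<phi>\<close> from \<open>X\<^sub>j\<close> uses up the factor of the observation \<open>i\<close>. Of the other
  \<open>n - 2\<close> observations, those in \<open>S\<close> contribute \<open>F x\<close> each and the rest \<open>1 - F x\<close> each; whether \<open>i\<close> is in \<open>S\<close>
  decides which power is one lower.
\<close>
lemma nn_integral_split:
  assumes jS: "(j, S) \<in> splits k" and k: "2 \<le> k" "k \<le> n - 1" and i: "i \<in> {1..n} - {j}"
    and f [measurable]: "f \<in> borel_measurable borel"
    and \<phi> [measurable]: "(\<lambda>p. \<phi> (fst p) (snd p)) \<in> borel_measurable (borel \<Otimes>\<^sub>M borel)"
  shows "(\<integral>\<^sup>+w. f (X j w) * \<phi> (X j w) (X i w) * (\<Prod>m\<in>{1..n} - {j}. side S m (X j w) (X m w)) \<partial>M) =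
    (\<integral>\<^sup>+x. f x * (if i \<in> S
      then (\<integral>\<^sup>+y. \<phi> x y * indicator {..<x} y \<partial>D) * (ennreal (cdf D x) ^ (k - 2) * ennreal (1 - cdf D x) ^ (n - k))
      else (\<integral>\<^sup>+y. \<phi> x y * indicator {x<..} y \<partial>D) * (ennreal (cdf D x) ^ (k - 1) * ennreal (1 - cdf D x) ^ (n - k - 1))) \<partial>D)"
proof -
  have j: "j \<in> {1..n}" and S: "S \<subseteq> {1..n} - {j}" "card S = k - 1"
    using jS by (auto simp: splits_def)
  have finS: "finite S" using S(1) by (rule finite_subset) simp
  define g where "g m x y = (if m = i then \<phi> x y else 1) * side S m x y" for m x y
  have g: "(\<lambda>(x, y). g m x y) \<in> borel_measurable (borel \<Otimes>\<^sub>M borel)" for m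
    unfolding g_def case_prod_beta by measurable
  let ?J = "{1..n} - {j}"
  have "f (X j w) * \<phi> (X j w) (X i w) * (\<Prod>m\<in>?J. side S m (X j w) (X m w)) =
      f (X j w) * (\<Prod>m\<in>?J. g m (X j w) (X m w))" for w
    using i by (simp add: g_def prod.distrib prod.delta mult.assoc)
  hence "(\<integral>\<^sup>+w. f (X j w) * \<phi> (X j w) (X i w) * (\<Prod>m\<in>?J. side S m (X j w) (X m w)) \<partial>M) =
      (\<integral>\<^sup>+w. f (X j w) * (\<Prod>m\<in>?J. g m (X j w) (X m w)) \<partial>M)"
    by simp
  also have "\<dots> = (\<integral>\<^sup>+x. f x * (\<Prod>m\<in>?J. \<integral>\<^sup>+y. g m x y \<partial>D) \<partial>D)"
    by (rule nn_integral_condition_on[OF j f g])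
  finally have eq: "(\<integral>\<^sup>+w. f (X j w) * \<phi> (X j w) (X i w) * (\<Prod>m\<in>?J. side S m (X j w) (X m w)) \<partial>M) =
      (\<integral>\<^sup>+x. f x * (\<Prod>m\<in>?J. \<integral>\<^sup>+y. g m x y \<partial>D) \<partial>D)" .
  have prod_eq: "(\<Prod>m\<in>?J. \<integral>\<^sup>+y. g m x y \<partial>D) = (if i \<in> S
      then (\<integral>\<^sup>+y. \<phi> x y * indicator {..<x} y \<partial>D) * (ennreal (cdf D x) ^ (k - 2) * ennreal (1 - cdf D x) ^ (n - k))
      else (\<integral>\<^sup>+y. \<phi> x y * indicator {x<..} y \<partial>D) * (ennreal (cdf D x) ^ (k - 1) * ennreal (1 - cdf D x) ^ (n - k - 1)))"
    (is "_ = ?rhs") for x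
  proof -
    have "(\<Prod>m\<in>?J. \<integral>\<^sup>+y. g m x y \<partial>D) =
        (\<integral>\<^sup>+y. \<phi> x y * side S i x y \<partial>D) * (\<Prod>m\<in>?J - {i}. \<integral>\<^sup>+y. g m x y \<partial>D)"
      using i by (subst prod.remove[of _ i]) (auto simp: g_def[abs_def])
    also have "(\<Prod>m\<in>?J - {i}. \<integral>\<^sup>+y. g m x y \<partial>D) =
        (\<Prod>m\<in>?J - {i}. if m \<in> S then ennreal (cdf D x) else ennreal (1 - cdf D x))"
      by (intro prod.cong refl) (auto simp: g_def[abs_def] nn_integral_side)
    also have "\<dots> = ennreal (cdf D x) ^ card (S - {i}) * ennreal (1 - cdf D x) ^ card (?J - {i} - S)"
    proof -
      have "(?J - {i}) \<inter> {m. m \<in> S} = S - {i}" "(?J - {i}) \<inter> - {m. m \<in> S} = ?J - {i} - S"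
        using S(1) by auto
      thus ?thesis by (simp add: prod.If_cases)
    qed
    finally have *: "(\<Prod>m\<in>?J. \<integral>\<^sup>+y. g m x y \<partial>D) = (\<integral>\<^sup>+y. \<phi> x y * side S i x y \<partial>D) *
        (ennreal (cdf D x) ^ card (S - {i}) * ennreal (1 - cdf D x) ^ card (?J - {i} - S))" .
    have cJ: "card ?J = n - 1" using j by simp
    have cJS: "card (?J - S) = n - k"
      using k unfolding card_Diff_subset[OF finS S(1)] cJ S(2) by simp
    show ?thesis
    proof (cases "i \<in> S")
      case True
      have "?J - {i} - S = ?J - S" using True by auto
      hence c1: "card (?J - {i} - S) = n - k" using cJS by simp
      have c2: "card (S - {i}) = k - 2" using True finS S(2) by simp
      show ?thesis
        unfolding * c1 c2 using True by (simp only: side_def if_True)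
    next
      case False
      have "?J - {i} - S = (?J - S) - {i}" by auto
      hence c1: "card (?J - {i} - S) = n - k - 1"
        using False i cJS by simp
      have c2: "card (S - {i}) = k - 1" using False S(2) by simp
      show ?thesis
        unfolding * c1 c2 using False by (simp only: side_def if_False)
    qed
  qed
  show ?thesis
    unfolding eq prod_eq ..
qed

text \<open>
  All pieces \<open>(j, S)\<close> have the same integral, so only their number enters. The assumption
  \<open>\<phi> x x = 0\<close> removes the \<open>k\<close>-th smallest observation itself from the sum.
\<close>
lemma nn_integral_order_stat_sum:
  assumes k: "2 \<le> k" "k \<le> n - 1"
    and f [measurable]: "f \<in> borel_measurable borel"
    and \<phi> [measurable]: "(\<lambda>p. \<phi> (fst p) (snd p)) \<in> borel_measurable (borel \<Otimes>\<^sub>M borel)"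
    and \<phi>0: "\<And>x. \<phi> x x = 0"
  shows "(\<integral>\<^sup>+w. f (order_stat X n k w) * (\<Sum>m = 1..n. \<phi> (order_stat X n k w) (X m w)) \<partial>M) =
    of_nat (card (splits k)) *
      (of_nat (k - 1) * (\<integral>\<^sup>+x. f x * ((\<integral>\<^sup>+y. \<phi> x y * indicator {..<x} y \<partial>D) *
        (ennreal (cdf D x) ^ (k - 2) * ennreal (1 - cdf D x) ^ (n - k))) \<partial>D) +
       of_nat (n - k) * (\<integral>\<^sup>+x. f x * ((\<integral>\<^sup>+y. \<phi> x y * indicator {x<..} y \<partial>D) *
        (ennreal (cdf D x) ^ (k - 1) * ennreal (1 - cdf D x) ^ (n - k - 1))) \<partial>D))"
    (is "_ = _ * (_ * ?a + _ * ?b)")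
proof -
  have sm [measurable]: "(\<lambda>w. side S m (X j w) (X m w)) \<in> borel_measurable M"
    if [measurable]: "j \<in> {1..n}" "m \<in> {1..n}" for S j m
  proof -
    have "(\<lambda>w. (X j w, X m w)) \<in> M \<rightarrow>\<^sub>M borel \<Otimes>\<^sub>M borel" by measurable
    from measurable_compose[OF this measurable_side] show ?thesis by simp
  qed
  have pm [measurable]: "(\<lambda>w. \<phi> (X j w) (X m w)) \<in> borel_measurable M"
    if [measurable]: "j \<in> {1..n}" "m \<in> {1..n}" for j m
  proof -
    have "(\<lambda>w. (X j w, X m w)) \<in> M \<rightarrow>\<^sub>M borel \<Otimes>\<^sub>M borel" by measurable
    from measurable_compose[OF this \<phi>] show ?thesis by simp
  qed
  let ?P = "\<lambda>j S w. \<Prod>m\<in>{1..n} - {j}. side S m (X j w) (X m w)"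
  let ?t = "\<lambda>j S i w. f (X j w) * \<phi> (X j w) (X i w) * ?P j S w"
  have mt [measurable]: "?t j S i \<in> borel_measurable M" if "j \<in> {1..n}" "i \<in> {1..n}" for j S i
    using that by (intro borel_measurable_times_ennreal borel_measurable_prod_ennreal sm pm
        measurable_compose[OF measurable_sample f]) auto
  have pair: "(\<integral>\<^sup>+w. (\<Sum>i\<in>{1..n} - {j}. ?t j S i w) \<partial>M) = of_nat (k - 1) * ?a + of_nat (n - k) * ?b"
    if jS: "(j, S) \<in> splits k" for j S
  proof -
    have j: "j \<in> {1..n}" and S: "S \<subseteq> {1..n} - {j}" "card S = k - 1"
      using jS by (auto simp: splits_def)
    have finS: "finite S" using S(1) by (rule finite_subset) simp
    have "(\<integral>\<^sup>+w. (\<Sum>i\<in>{1..n} - {j}. ?t j S i w) \<partial>M) = (\<Sum>i\<in>{1..n} - {j}. \<integral>\<^sup>+w. ?t j S i w \<partial>M)"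
      by (intro nn_integral_sum mt) (use j in auto)
    also have "\<dots> = (\<Sum>i\<in>{1..n} - {j}. if i \<in> S then ?a else ?b)"
    proof (intro sum.cong refl)
      fix i assume "i \<in> {1..n} - {j}"
      from nn_integral_split[OF jS k this f \<phi>]
      show "(\<integral>\<^sup>+w. ?t j S i w \<partial>M) = (if i \<in> S then ?a else ?b)"
        by (cases "i \<in> S") (simp_all only: if_True if_False)
    qed
    also have "\<dots> = of_nat (card S) * ?a + of_nat (card ({1..n} - {j} - S)) * ?b"
    proof -
      have "({1..n} - {j}) \<inter> {i. i \<in> S} = S" "({1..n} - {j}) \<inter> - {i. i \<in> S} = {1..n} - {j} - S"
        using S(1) by auto
      thus ?thesis by (simp add: sum.If_cases)
    qed
    also have "card ({1..n} - {j} - S) = n - k"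
      using S finS j k by (subst card_Diff_subset) auto
    finally show ?thesis using S(2) by simp
  qed
  have "(\<integral>\<^sup>+w. f (order_stat X n k w) * (\<Sum>m = 1..n. \<phi> (order_stat X n k w) (X m w)) \<partial>M) =
      (\<integral>\<^sup>+w. (\<Sum>(j, S)\<in>splits k. \<Sum>i\<in>{1..n} - {j}. ?t j S i w) \<partial>M)"
  proof (rule nn_integral_cong_AE)
    show "AE w in M. f (order_stat X n k w) * (\<Sum>m = 1..n. \<phi> (order_stat X n k w) (X m w)) =
        (\<Sum>(j, S)\<in>splits k. \<Sum>i\<in>{1..n} - {j}. ?t j S i w)"
      using AE_no_ties
    proof eventually_elim
      case (elim w)
      have "f (order_stat X n k w) * (\<Sum>m = 1..n. \<phi> (order_stat X n k w) (X m w)) =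
          (\<Sum>(j, S)\<in>splits k. (f (X j w) * (\<Sum>m = 1..n. \<phi> (X j w) (X m w))) * ?P j S w)"
        using k elim by (subst sum_splits[where \<psi> = "\<lambda>x. f x * (\<Sum>m = 1..n. \<phi> x (X m w))"]) auto
      also have "\<dots> = (\<Sum>(j, S)\<in>splits k. \<Sum>i\<in>{1..n} - {j}. ?t j S i w)"
      proof (intro sum.cong refl, clarify)
        fix j S assume "(j, S) \<in> splits k"
        hence "j \<in> {1..n}" by (auto simp: splits_def)
        hence "(\<Sum>m = 1..n. \<phi> (X j w) (X m w)) = (\<Sum>m\<in>{1..n} - {j}. \<phi> (X j w) (X m w))"
          by (subst sum.remove[of _ j]) (auto simp: \<phi>0)
        thus "(f (X j w) * (\<Sum>m = 1..n. \<phi> (X j w) (X m w))) * ?P j S w =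
            (\<Sum>i\<in>{1..n} - {j}. ?t j S i w)"
          by (simp add: sum_distrib_left sum_distrib_right)
      qed
      finally show ?case .
    qed
  qed
  also have "\<dots> = (\<Sum>p\<in>splits k. \<integral>\<^sup>+w. (case p of (j, S) \<Rightarrow> \<Sum>i\<in>{1..n} - {j}. ?t j S i w) \<partial>M)"
    by (intro nn_integral_sum) (auto simp: splits_def intro!: borel_measurable_sum mt)
  also have "\<dots> = (\<Sum>p\<in>splits k. of_nat (k - 1) * ?a + of_nat (n - k) * ?b)"
  proof (intro sum.cong refl)
    fix p assume p: "p \<in> splits k"
    obtain j S where "p = (j, S)" by (cases p)
    with pair[of j S] p show "(\<integral>\<^sup>+w. (case p of (j, S) \<Rightarrow> \<Sum>i\<in>{1..n} - {j}. ?t j S i w) \<partial>M) =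
        of_nat (k - 1) * ?a + of_nat (n - k) * ?b"
      by (simp only: prod.case)
  qed
  finally show ?thesis by simp
qed

lemma measurable_order_stat:
  assumes "1 \<le> k" "k \<le> n"
  shows "order_stat X n k \<in> borel_measurable M"
  by (rule borel_measurable_order_stat[OF measurable_sample assms])

text \<open>
  With \<open>\<phi>\<close> the positive part of \<open>x - y\<close> only the \<open>k - 1\<close> observations below contribute, and their
  number cancels against the normalization of the average.
\<close>
lemma nn_integral_below:
  assumes k: "2 \<le> k" "k \<le> n - 1" and B [measurable]: "B \<in> sets borel"
  shows "(\<integral>\<^sup>+w. indicator B (order_stat X n k w) * ennreal (1 / (real k - 1) *
      (\<Sum>i = 1..k - 1. order_stat X n k w - order_stat X n i w)) \<partial>M) =
    of_nat (card (splits k)) * (\<integral>\<^sup>+x. indicator B x *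
      ennreal (lower x * (cdf D x ^ (k - 2) * (1 - cdf D x) ^ (n - k))) \<partial>D)"
proof -
  have [measurable]: "order_stat X n k \<in> borel_measurable M"
    using k by (intro measurable_order_stat) auto
  define c where "c = 1 / (real k - 1)"
  have c: "0 \<le> c" using k by (simp add: c_def)
  have "of_nat (k - 1) = ennreal (real (k - 1))"
    by (rule ennreal_of_nat_eq_real_of_nat)
  hence c_cancel: "ennreal c * of_nat (k - 1) = 1"
    using k by (simp add: c_def of_nat_diff flip: ennreal_mult)
  define \<phi> where "\<phi> x y = ennreal (max (x - y) 0)" for x y :: real
  have \<phi>m: "(\<lambda>p. \<phi> (fst p) (snd p)) \<in> borel_measurable (borel \<Otimes>\<^sub>M borel)"
    unfolding \<phi>_def by measurable
  have \<phi>0: "\<phi> x x = 0" for x by (simp add: \<phi>_def)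
  have near: "(\<integral>\<^sup>+y. \<phi> x y * indicator {..<x} y \<partial>D) = ennreal (lower x)" for x
  proof -
    have "(\<integral>\<^sup>+y. \<phi> x y * indicator {..<x} y \<partial>D) = (\<integral>\<^sup>+y. ennreal (max (x - y) 0) \<partial>D)"
      by (intro nn_integral_cong) (auto simp: \<phi>_def indicator_def not_less ennreal_neg)
    also have "\<dots> = ennreal (\<integral>y. max (x - y) 0 \<partial>D)"
      by (intro nn_integral_eq_integral integrable_lower) auto
    finally show ?thesis by (simp add: lower_def)
  qed
  have far: "\<phi> x y * indicator {x<..} y = 0" for x y
    by (auto simp: \<phi>_def indicator_def ennreal_neg)
  have "ennreal (c * (\<Sum>i = 1..k - 1. order_stat X n k w - order_stat X n i w)) =
      ennreal c * (\<Sum>m = 1..n. \<phi> (order_stat X n k w) (X m w))" for w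
  proof -
    have "(\<Sum>i = 1..k - 1. order_stat X n k w - order_stat X n i w) = (\<Sum>m = 1..n. max (order_stat X n k w - X m w) 0)"
      using k by (intro sum_below_order_stat) auto
    thus ?thesis
      unfolding \<phi>_def using c by (simp only: sum_ennreal max.cobounded2 ennreal_mult sum_nonneg)
  qed
  hence "(\<integral>\<^sup>+w. indicator B (order_stat X n k w) * ennreal (c * (\<Sum>i = 1..k - 1. order_stat X n k w - order_stat X n i w)) \<partial>M) =
      (\<integral>\<^sup>+w. ennreal c * (indicator B (order_stat X n k w) *
        (\<Sum>m = 1..n. \<phi> (order_stat X n k w) (X m w))) \<partial>M)"
    by (simp only: mult.left_commute)
  also have "\<dots> = ennreal c * (\<integral>\<^sup>+w. indicator B (order_stat X n k w) *
        (\<Sum>m = 1..n. \<phi> (order_stat X n k w) (X m w)) \<partial>M)"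
    unfolding \<phi>_def by (intro nn_integral_cmult) measurable
  also have "\<dots> = ennreal c * of_nat (k - 1) * (of_nat (card (splits k)) *
      (\<integral>\<^sup>+x. indicator B x * (ennreal (lower x) * (ennreal (cdf D x) ^ (k - 2) * ennreal (1 - cdf D x) ^ (n - k))) \<partial>D))"
    using nn_integral_order_stat_sum[OF k borel_measurable_indicator[OF B] \<phi>m \<phi>0]
    by (simp only: near far nn_integral_const mult_zero_left mult_zero_right add_0_left add_0_right mult_ac)
  also have "\<dots> = of_nat (card (splits k)) *
      (\<integral>\<^sup>+x. indicator B x * ennreal (lower x * (cdf D x ^ (k - 2) * (1 - cdf D x) ^ (n - k))) \<partial>D)"
    unfolding c_cancel
    by (simp add: ennreal_mult'' ennreal_power cdf_nonneg cdf_bounded_prob lower_nonneg)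
  finally show ?thesis by (simp only: c_def)
qed

text \<open>
  The same with the \<open>n - k\<close> observations above. The factor in front is again the number of splits,
  so it drops out when the two identities are compared.
\<close>
lemma nn_integral_above:
  assumes k: "2 \<le> k" "k \<le> n - 1" and B [measurable]: "B \<in> sets borel"
  shows "(\<integral>\<^sup>+w. indicator B (order_stat X n k w) * ennreal (1 / (real n - real k) *
      (\<Sum>j = k + 1..n. order_stat X n j w - order_stat X n k w)) \<partial>M) =
    of_nat (card (splits k)) * (\<integral>\<^sup>+x. indicator B x *
      ennreal (upper x * (cdf D x ^ (k - 1) * (1 - cdf D x) ^ (n - k - 1))) \<partial>D)"
proof -
  have [measurable]: "order_stat X n k \<in> borel_measurable M"
    using k by (intro measurable_order_stat) auto
  define c where "c = 1 / (real n - real k)"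
  have c: "0 \<le> c" using k by (simp add: c_def)
  have "of_nat (n - k) = ennreal (real (n - k))"
    by (rule ennreal_of_nat_eq_real_of_nat)
  hence c_cancel: "ennreal c * of_nat (n - k) = 1"
    using k by (simp add: c_def of_nat_diff flip: ennreal_mult)
  define \<phi> where "\<phi> x y = ennreal (max (y - x) 0)" for x y :: real
  have \<phi>m: "(\<lambda>p. \<phi> (fst p) (snd p)) \<in> borel_measurable (borel \<Otimes>\<^sub>M borel)"
    unfolding \<phi>_def by measurable
  have \<phi>0: "\<phi> x x = 0" for x by (simp add: \<phi>_def)
  have near: "(\<integral>\<^sup>+y. \<phi> x y * indicator {x<..} y \<partial>D) = ennreal (upper x)" for x
  proof -
    have "(\<integral>\<^sup>+y. \<phi> x y * indicator {x<..} y \<partial>D) = (\<integral>\<^sup>+y. ennreal (max (y - x) 0) \<partial>D)"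
      by (intro nn_integral_cong) (auto simp: \<phi>_def indicator_def not_less ennreal_neg)
    also have "\<dots> = ennreal (\<integral>y. max (y - x) 0 \<partial>D)"
      by (intro nn_integral_eq_integral integrable_upper) auto
    finally show ?thesis by (simp add: upper_def)
  qed
  have far: "\<phi> x y * indicator {..<x} y = 0" for x y
    by (auto simp: \<phi>_def indicator_def ennreal_neg)
  have "ennreal (c * (\<Sum>j = k + 1..n. order_stat X n j w - order_stat X n k w)) =
      ennreal c * (\<Sum>m = 1..n. \<phi> (order_stat X n k w) (X m w))" for w
  proof -
    have "(\<Sum>j = k + 1..n. order_stat X n j w - order_stat X n k w) = (\<Sum>m = 1..n. max (X m w - order_stat X n k w) 0)"
      using k by (intro sum_above_order_stat) auto
    thus ?thesis
      unfolding \<phi>_def using c by (simp only: sum_ennreal max.cobounded2 ennreal_mult sum_nonneg)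
  qed
  hence "(\<integral>\<^sup>+w. indicator B (order_stat X n k w) * ennreal (c * (\<Sum>j = k + 1..n. order_stat X n j w - order_stat X n k w)) \<partial>M) =
      (\<integral>\<^sup>+w. ennreal c * (indicator B (order_stat X n k w) *
        (\<Sum>m = 1..n. \<phi> (order_stat X n k w) (X m w))) \<partial>M)"
    by (simp only: mult.left_commute)
  also have "\<dots> = ennreal c * (\<integral>\<^sup>+w. indicator B (order_stat X n k w) *
        (\<Sum>m = 1..n. \<phi> (order_stat X n k w) (X m w)) \<partial>M)"
    unfolding \<phi>_def by (intro nn_integral_cmult) measurable
  also have "\<dots> = ennreal c * of_nat (n - k) * (of_nat (card (splits k)) *
      (\<integral>\<^sup>+x. indicator B x * (ennreal (upper x) * (ennreal (cdf D x) ^ (k - 1) * ennreal (1 - cdf D x) ^ (n - k - 1))) \<partial>D))"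
    using nn_integral_order_stat_sum[OF k borel_measurable_indicator[OF B] \<phi>m \<phi>0]
    by (simp only: near far nn_integral_const mult_zero_left mult_zero_right add_0_left add_0_right mult_ac)
  also have "\<dots> = of_nat (card (splits k)) *
      (\<integral>\<^sup>+x. indicator B x * ennreal (upper x * (cdf D x ^ (k - 1) * (1 - cdf D x) ^ (n - k - 1))) \<partial>D)"
    unfolding c_cancel
    by (simp add: ennreal_mult'' ennreal_power cdf_nonneg cdf_bounded_prob upper_nonneg)
  finally show ?thesis by (simp only: c_def)
qed

section \<open>The characterization\<close>

lemma integrable_order_stat:
  assumes k: "1 \<le> k" "k \<le> n"
  shows "integrable M (order_stat X n k)"
proof -
  have int: "integrable M (X i)" if "i \<in> {1..n}" for i
    using integrable_distr[OF measurable_sample[OF that], of "\<lambda>y. y"] integrable_id law[OF that]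
    by (auto)
  have "integrable M (\<lambda>w. \<Sum>m = 1..n. \<bar>X m w\<bar>)"
    by (intro Bochner_Integration.integrable_sum integrable_abs int)
  thus ?thesis
  proof (rule Bochner_Integration.integrable_bound)
    show "AE w in M. norm (order_stat X n k w) \<le> norm (\<Sum>m = 1..n. \<bar>X m w\<bar>)"
      using abs_order_stat_le[OF k, of X] by (auto simp: sum_nonneg)
  qed (rule measurable_order_stat[OF k])
qed

text \<open>
  The densities from \<open>nn_integral_below\<close> and \<open>nn_integral_above\<close> differ by
  \<open>F x ^ (k - 2) * (1 - F x) ^ (n - k - 1)\<close> times the imbalance. Where that factor vanishes, \<open>F x\<close> is
  \<open>0\<close> or \<open>1\<close>; then the mean deviation on the empty side vanishes too, and so does the imbalance.
\<close>
lemma cond_exp_balance_iff: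
  assumes k: "2 \<le> k" "k \<le> n - 1"
  shows "(AE x in distr M borel (order_stat X n k).
      cond_exp_given M (\<lambda>w. 1 / (real k - 1) *
          (\<Sum>i = 1..k - 1. order_stat X n k w - order_stat X n i w)) (order_stat X n k) x =
      cond_exp_given M (\<lambda>w. 1 / (real n - real k) *
          (\<Sum>j = k + 1..n. order_stat X n j w - order_stat X n k w)) (order_stat X n k) x) \<longleftrightarrow>
    (AE x in D. imbalance x = 0)"
    (is "(AE x in _. cond_exp_given M ?L ?Z x = cond_exp_given M ?U ?Z x) \<longleftrightarrow> _")
proof -
  define u where "u x = lower x * (cdf D x ^ (k - 2) * (1 - cdf D x) ^ (n - k))" for x
  define v where "v x = upper x * (cdf D x ^ (k - 1) * (1 - cdf D x) ^ (n - k - 1))" for x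
  have sets_D [measurable_cong]: "sets D = sets borel" by (rule M_is_borel)
  have [measurable]: "u \<in> borel_measurable borel" "v \<in> borel_measurable borel"
    unfolding u_def v_def by measurable
  have F: "0 \<le> cdf D x" "cdf D x \<le> 1" for x
    by (auto simp: cdf_nonneg cdf_bounded_prob)
  have uv: "0 \<le> u x" "0 \<le> v x" for x
    using F[of x] by (auto simp: u_def v_def lower_nonneg upper_nonneg)
  have "(AE x in distr M borel ?Z. cond_exp_given M ?L ?Z x = cond_exp_given M ?U ?Z x) \<longleftrightarrow>
      (\<forall>B\<in>sets borel. (\<integral>\<^sup>+w. indicator B (?Z w) * ennreal (?L w) \<partial>M) =
        (\<integral>\<^sup>+w. indicator B (?Z w) * ennreal (?U w) \<partial>M))"
  proof (rule M.cond_exp_given_eq_iff)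
    show "?Z \<in> borel_measurable M"
      using k by (intro measurable_order_stat) auto
    show "integrable M ?L" "integrable M ?U"
      using k by (intro integrable_mult_right Bochner_Integration.integrable_sum
          Bochner_Integration.integrable_diff integrable_order_stat; auto)+
    show "0 \<le> ?L w" "0 \<le> ?U w" for w
      using k by (intro mult_nonneg_nonneg sum_nonneg; auto intro!: order_stat_mono)+
  qed
  also have "\<dots> \<longleftrightarrow> (\<forall>B\<in>sets borel. of_nat (card (splits k)) * (\<integral>\<^sup>+x. indicator B x * ennreal (u x) \<partial>D) =
        of_nat (card (splits k)) * (\<integral>\<^sup>+x. indicator B x * ennreal (v x) \<partial>D))"
    using k by (intro ball_cong refl) (simp only: nn_integral_below nn_integral_above u_def v_def)
  also have "\<dots> \<longleftrightarrow> (\<forall>B\<in>sets borel. (\<integral>\<^sup>+x. indicator B x * ennreal (u x) \<partial>D) =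
        (\<integral>\<^sup>+x. indicator B x * ennreal (v x) \<partial>D))"
  proof -
    have "of_nat (card (splits k)) \<noteq> (0 :: ennreal)"
      using splits_nonempty[of k] finite_splits[of k] k by auto
    thus ?thesis
      by (simp add: ennreal_mult_cancel_left)
  qed
  also have "\<dots> \<longleftrightarrow> density D (\<lambda>x. ennreal (u x)) = density D (\<lambda>x. ennreal (v x))"
  proof
    assume eq: "\<forall>B\<in>sets borel. (\<integral>\<^sup>+x. indicator B x * ennreal (u x) \<partial>D) =
        (\<integral>\<^sup>+x. indicator B x * ennreal (v x) \<partial>D)"
    show "density D (\<lambda>x. ennreal (u x)) = density D (\<lambda>x. ennreal (v x))"
      by (rule measure_eqI) (use eq sets_D in \<open>auto simp: emeasure_density mult.commute\<close>)
  next
    assume eq: "density D (\<lambda>x. ennreal (u x)) = density D (\<lambda>x. ennreal (v x))"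
    have "(\<integral>\<^sup>+x. indicator B x * ennreal (f x) \<partial>D) = emeasure (density D (\<lambda>x. ennreal (f x))) B"
      if [measurable]: "B \<in> sets borel" "f \<in> borel_measurable borel" for B and f :: "real \<Rightarrow> real"
      by (subst emeasure_density) (auto simp: mult.commute)
    thus "\<forall>B\<in>sets borel. (\<integral>\<^sup>+x. indicator B x * ennreal (u x) \<partial>D) =
        (\<integral>\<^sup>+x. indicator B x * ennreal (v x) \<partial>D)"
      using eq by simp
  qed
  also have "\<dots> \<longleftrightarrow> (AE x in D. ennreal (u x) = ennreal (v x))"
    by (rule density_unique_iff) measurable
  also have "\<dots> \<longleftrightarrow> (AE x in D. imbalance x = 0)"
  proof (rule AE_cong)
    fix x
    define w where "w = cdf D x ^ (k - 2) * (1 - cdf D x) ^ (n - k - 1)"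
    define a b where "a = n - k - 1" and "b = k - 2"
    have "n - k = Suc a" "k - 1 = Suc b" "n - k - 1 = a" "k - 2 = b"
      using k by (auto simp: a_def b_def)
    hence "u x = w * (lower x * (1 - cdf D x))" "v x = w * (upper x * cdf D x)"
      unfolding u_def v_def w_def by simp_all
    hence diff: "u x - v x = w * imbalance x"
      by (simp add: imbalance_def algebra_simps)
    have zero: "imbalance x = 0" if "w = 0"
    proof -
      have "cdf D x = 0 \<or> cdf D x = 1"
        using that by (auto simp: w_def)
      thus ?thesis
        using lower_eq_0_if_cdf_eq_0[of x] upper_eq_0_if_cdf_eq_1[of x] by (auto simp: imbalance_def)
    qed
    have "ennreal (u x) = ennreal (v x) \<longleftrightarrow> u x - v x = 0"
      using uv[of x] by simp
    also have "\<dots> \<longleftrightarrow> imbalance x = 0"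
      unfolding diff using zero by auto
    finally show "ennreal (u x) = ennreal (v x) \<longleftrightarrow> imbalance x = 0" .
  qed
  finally show ?thesis .
qed

end

theorem mainTheorem3:
  fixes P :: "'a measure" and X :: "'a \<Rightarrow> real" and F :: "real \<Rightarrow> real"
    and M :: "'b measure" and Xs :: "nat \<Rightarrow> 'b \<Rightarrow> real" and n :: nat
  assumes "prob_space P"
    and "X \<in> borel_measurable P"
    and "F = cdf (distr P borel X)"
    and "absolutely_continuous lborel (distr P borel X)"
    and "integrable P X"
    and "n \<ge> 3"
    and "prob_space M"
    and "prob_space.indep_vars M (\<lambda>_. borel) Xs {1..n}"
    and "\<forall>i\<in>{1..n}. cdf (distr M borel (Xs i)) = F"
  shows "(\<exists>\<mu> \<sigma> :: real. \<sigma> > 0 \<and> (\<forall>x. F x = t2_cdf ((x - \<mu>) / \<sigma>))) \<longleftrightarrow>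
    (\<exists>k. 2 \<le> k \<and> k \<le> n - 1 \<and>
      (AE x in distr M borel (order_stat Xs n k).
        cond_exp_given M
          (\<lambda>w. 1 / (real k - 1) *
            (\<Sum>i = 1..k - 1. order_stat Xs n k w - order_stat Xs n i w))
          (order_stat Xs n k) x =
        cond_exp_given M
          (\<lambda>w. 1 / (real n - real k) *
            (\<Sum>j = k + 1..n. order_stat Xs n j w - order_stat Xs n k w))
          (order_stat Xs n k) x))"
proof -
  interpret P: prob_space P by fact
  interpret M: prob_space M by fact
  define D where "D = distr P borel X"
  have D: "real_distribution D"
    unfolding D_def by (rule P.real_distribution_distr) fact
  interpret real_distribution D by fact
  have F: "F = cdf D"
    using assms(3) by (simp add: D_def)
  have sample: "Xs i \<in> borel_measurable M" if "i \<in> {1..n}" for i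
    using assms(8) that by (auto simp: M.indep_vars_def)
  interpret iid_sample D M Xs n
  proof (unfold_locales)
    fix x :: real
    have "{x} \<in> null_sets lborel"
      by (auto simp: null_sets_def)
    hence "{x} \<in> null_sets D"
      using assms(4) unfolding absolutely_continuous_def D_def by blast
    thus "measure D {x} = 0"
      by (simp add: null_sets_def measure_def)
  next
    show "integrable D (\<lambda>y. y)"
      unfolding D_def using assms(2,5) by (subst integrable_distr_eq) auto
  next
    show "M.indep_vars (\<lambda>_. borel) Xs {1..n}"
      by fact
  next
    fix i assume i: "i \<in> {1..n}"
    show "distr M borel (Xs i) = D"
    proof (rule cdf_unique)
      show "real_distribution (distr M borel (Xs i))"
        using sample[OF i] by (rule M.real_distribution_distr)
      show "cdf (distr M borel (Xs i)) = cdf D"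
        using assms(9) i by (simp add: F)
    qed (rule D)
  qed
  show ?thesis
  proof
    assume "\<exists>\<mu> \<sigma>. \<sigma> > 0 \<and> (\<forall>x. F x = t2_cdf ((x - \<mu>) / \<sigma>))"
    then obtain \<mu> \<sigma> where "\<sigma> > 0" "\<And>x. cdf D x = t2_cdf ((x - \<mu>) / \<sigma>)"
      by (auto simp: F)
    hence "imbalance x = 0" for x
      by (rule balanced_if_t2)
    hence "AE x in D. imbalance x = 0"
      by simp
    with assms(6) show "\<exists>k. 2 \<le> k \<and> k \<le> n - 1 \<and> (AE x in distr M borel (order_stat Xs n k).
        cond_exp_given M (\<lambda>w. 1 / (real k - 1) *
            (\<Sum>i = 1..k - 1. order_stat Xs n k w - order_stat Xs n i w)) (order_stat Xs n k) x =
        cond_exp_given M (\<lambda>w. 1 / (real n - real k) *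
            (\<Sum>j = k + 1..n. order_stat Xs n j w - order_stat Xs n k w)) (order_stat Xs n k) x)"
      \<comment> \<open>Every admissible \<open>k\<close> would do; \<open>2\<close> is admissible because \<open>n \<ge> 3\<close>.\<close>
      by (intro exI[of _ 2] conjI cond_exp_balance_iff[THEN iffD2]) auto
  next
    assume "\<exists>k. 2 \<le> k \<and> k \<le> n - 1 \<and> (AE x in distr M borel (order_stat Xs n k).
        cond_exp_given M (\<lambda>w. 1 / (real k - 1) *
            (\<Sum>i = 1..k - 1. order_stat Xs n k w - order_stat Xs n i w)) (order_stat Xs n k) x =
        cond_exp_given M (\<lambda>w. 1 / (real n - real k) *
            (\<Sum>j = k + 1..n. order_stat Xs n j w - order_stat Xs n k w)) (order_stat Xs n k) x)"
    then obtain k where "2 \<le> k" "k \<le> n - 1" "AE x in distr M borel (order_stat Xs n k).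
        cond_exp_given M (\<lambda>w. 1 / (real k - 1) *
            (\<Sum>i = 1..k - 1. order_stat Xs n k w - order_stat Xs n i w)) (order_stat Xs n k) x =
        cond_exp_given M (\<lambda>w. 1 / (real n - real k) *
            (\<Sum>j = k + 1..n. order_stat Xs n j w - order_stat Xs n k w)) (order_stat Xs n k) x"
      by blast
    hence "AE x in D. imbalance x = 0"
      by (simp only: cond_exp_balance_iff)
    thus "\<exists>\<mu> \<sigma>. \<sigma> > 0 \<and> (\<forall>x. F x = t2_cdf ((x - \<mu>) / \<sigma>))"
      unfolding F by (rule t2_if_balanced)
  qed
qed

end
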